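(* Let $(S,\mathcal F,\mathcal L)$ be a $p$-local finite group at an odd prime $p$. Then $(S,\mathcal F,\mathcal L)$ is nilpotent if and only if every elementary abelian normal subgroup $V\trianglelefteq S$ is $\mathcal F$-weakly closed and $\mathrm{Aut}_{\mathcal F}(V)$ is a $p$-group.
   Context: A subgroup of $S$ is $\mathcal F$-weakly closed if no other subgroup of $S$ is $\mathcal F$-conjugate to it. Let $S$ be a finite $p$-group. For $P,Q\le S$, $\mathrm{Hom}_S(P,Q)$ is the set of maps $c_g\colon x\mapsto gxg^{-1}$ with $g\in S$, $gPg^{-1}\le Q$, and $\mathrm{Aut}_S(P)=\mathrm{Hom}_S(P,P)$. A fusion system $\mathcal F$ over $S$ is a category whose objects are the subgroups of $S$, with $\mathrm{Hom}_S(P,Q)\subseteq\mathrm{Hom}_{\mathcal F}(P,Q)\subseteq \mathrm{Inj}(P,Q)$, such that every morphism factors as an $\mathcal F$-isomorphism followed by an inclusion. Subgroups are $\mathcal F$-conjugate if they are isomorphic in $\mathcal F$. $P$ is fully centralized (resp. fully normalized) if $|C_S(P)|\ge |C_S(P')|$ (resp. $|N_S(P)|\ge|N_S(P')|$) for all $P'$ $\mathcal F$-conjugate to $P$. $\mathcal F$ is saturated if (I) every fully normalized $P$ is fully centralized and $\mathrm{Aut}_S(P)$ is a Sylow $p$-subgroup of $\mathrm{Aut}_{\mathcal F}(P)$, and (II) whenever $\phi\in\mathrm{Hom}_{\mathcal F}(P,S)$ with $\phi(P)$ fully centralized, $\phi$ extends to a morphism in $\mathcal F$ defined on $N_\phi=\{g\in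 N_S(P):\phi c_g\phi^{-1}\in \mathrm{Aut}_S(\phi(P))\}$. $P$ is $\mathcal F$-centric if $C_S(P')\le P'$ for all $P'$ $\mathcal F$-conjugate to $P$; $\mathcal F^c$ is the full subcategory on these. A centric linking system associated to $\mathcal F$ is a category $\mathcal L$ with objects the $\mathcal F$-centric subgroups, a functor $\pi\colon\mathcal L\to\mathcal F^c$ which is the identity on objects, and monomorphisms $\delta_P\colon P\to\mathrm{Aut}_{\mathcal L}(P)$, such that (A) $Z(P)$ (via $\delta_P$) acts freely on $\mathrm{Mor}_{\mathcal L}(P,Q)$ by composition and $\pi$ induces a bijection $\mathrm{Mor}_{\mathcal L}(P,Q)/Z(P)\to\mathrm{Hom}_{\mathcal F}(P,Q)$; (B) $\pi(\delta_P(g))=c_g$ for $g\in P$; (C) $f\circ\delta_P(g)=\delta_Q(\pi(f)(g))\circ f$ for $f\in\mathrm{Mor}_{\mathcal L}(P,Q)$, $g\in P$. A $p$-local finite group is a triple $(S,\mathcal F,\mathcal L)$ with $\mathcal F$ a saturated fusion system over $S$ and $\mathcal L$ an associated centric linking system. $(S,\mathcal F,\mathcal L)$ is called nilpotent if $\mathcal F=\mathcal F_S(S)$, the fusion system with $\mathrm{Hom}_{\mathcal F_S(S)}(P,Q)=\mathrm{Hom}_S(P,Q)$. *)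

theory Defs
  imports "HOL-Algebra.Algebra" "HOL-Library.FuncSet"
begin

text \<open>Fusion systems over a finite group S (HOL-Algebra). A fusion system is given by
  its morphism sets Hom P Q, where morphisms are functions 'a => 'a that are
  extensional on their domain P (values outside P are undefined).\<close>

definition cmap :: "('a,'b) monoid_scheme \<Rightarrow> 'a \<Rightarrow> 'a set \<Rightarrow> ('a \<Rightarrow> 'a)" where
  "cmap G g P = restrict (\<lambda>x. g \<otimes>\<^bsub>G\<^esub> x \<otimes>\<^bsub>G\<^esub> inv\<^bsub>G\<^esub> g) P"

definition conjset :: "('a,'b) monoid_scheme \<Rightarrow> 'a \<Rightarrow> 'a set \<Rightarrow> 'a set" where
  "conjset G g P = (\<lambda>x. g \<otimes>\<^bsub>G\<^esub> x \<otimes>\<^bsub>G\<^esub> inv\<^bsub>G\<^esub> g) ` P"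

definition HomS :: "('a,'b) monoid_scheme \<Rightarrow> 'a set \<Rightarrow> 'a set \<Rightarrow> ('a \<Rightarrow> 'a) set" where
  "HomS G P Q = {cmap G g P | g. g \<in> carrier G \<and> conjset G g P \<subseteq> Q}"

definition InjHom :: "('a,'b) monoid_scheme \<Rightarrow> 'a set \<Rightarrow> 'a set \<Rightarrow> ('a \<Rightarrow> 'a) set" where
  "InjHom G P Q = {\<phi>. \<phi> \<in> extensional P \<and> \<phi> ` P \<subseteq> Q \<and> inj_on \<phi> P \<and>
      (\<forall>x\<in>P. \<forall>y\<in>P. \<phi> (x \<otimes>\<^bsub>G\<^esub> y) = \<phi> x \<otimes>\<^bsub>G\<^esub> \<phi> y)}"

definition fusion_system ::
  "('a,'b) monoid_scheme \<Rightarrow> ('a set \<Rightarrow> 'a set \<Rightarrow> ('a \<Rightarrow> 'a) set) \<Rightarrow> bool" where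
  "fusion_system G Hom \<longleftrightarrow>
     (\<forall>P Q. subgroup P G \<and> subgroup Q G \<longrightarrow> HomS G P Q \<subseteq> Hom P Q \<and> Hom P Q \<subseteq> InjHom G P Q) \<and>
     (\<forall>P Q R. subgroup P G \<and> subgroup Q G \<and> subgroup R G \<longrightarrow>
        (\<forall>\<phi>\<in>Hom P Q. \<forall>\<psi>\<in>Hom Q R. compose P \<psi> \<phi> \<in> Hom P R)) \<and>
     (\<forall>P Q. subgroup P G \<and> subgroup Q G \<longrightarrow>
        (\<forall>\<phi>\<in>Hom P Q. \<phi> \<in> Hom P (\<phi> ` P) \<and> restrict (inv_into P \<phi>) (\<phi> ` P) \<in> Hom (\<phi> ` P) P))"

definition F_conj ::
  "('a set \<Rightarrow> 'a set \<Rightarrow> ('a \<Rightarrow> 'a) set) \<Rightarrow> 'a set \<Rightarrow> 'a set \<Rightarrow> bool" where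
  "F_conj Hom P Q \<longleftrightarrow> (\<exists>\<phi>\<in>Hom P Q. \<exists>\<psi>\<in>Hom Q P.
      compose P \<psi> \<phi> = restrict id P \<and> compose Q \<phi> \<psi> = restrict id Q)"

definition centralizerS :: "('a,'b) monoid_scheme \<Rightarrow> 'a set \<Rightarrow> 'a set" where
  "centralizerS G P = {g \<in> carrier G. \<forall>x\<in>P. g \<otimes>\<^bsub>G\<^esub> x = x \<otimes>\<^bsub>G\<^esub> g}"

definition normalizerS :: "('a,'b) monoid_scheme \<Rightarrow> 'a set \<Rightarrow> 'a set" where
  "normalizerS G P = {g \<in> carrier G. conjset G g P = P}"

definition center_of :: "('a,'b) monoid_scheme \<Rightarrow> 'a set \<Rightarrow> 'a set" where
  "center_of G P = {z \<in> P. \<forall>x\<in>P. z \<otimes>\<^bsub>G\<^esub> x = x \<otimes>\<^bsub>G\<^esub> z}"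

definition fully_centralized :: "('a,'b) monoid_scheme \<Rightarrow> ('a set \<Rightarrow> 'a set \<Rightarrow> ('a \<Rightarrow> 'a) set) \<Rightarrow> 'a set \<Rightarrow> bool" where
  "fully_centralized G Hom P \<longleftrightarrow>
  (\<forall>P'. subgroup P' G \<and> F_conj Hom P P' \<longrightarrow> card (centralizerS G P') \<le> card (centralizerS G P))"

definition fully_normalized :: "('a,'b) monoid_scheme \<Rightarrow> ('a set \<Rightarrow> 'a set \<Rightarrow> ('a \<Rightarrow> 'a) set) \<Rightarrow> 'a set \<Rightarrow> bool" where
  "fully_normalized G Hom P \<longleftrightarrow>
  (\<forall>P'. subgroup P' G \<and> F_conj Hom P P' \<longrightarrow> card (normalizerS G P') \<le> card (normalizerS G P))"

definition sylow_card :: "nat \<Rightarrow> nat \<Rightarrow> nat \<Rightarrow> bool" where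
  "sylow_card p h n \<longleftrightarrow> (\<exists>k. h = p ^ k \<and> p ^ k dvd n \<and> \<not> p ^ Suc k dvd n)"

definition N_phi :: "('a,'b) monoid_scheme \<Rightarrow> 'a set \<Rightarrow> ('a \<Rightarrow> 'a) \<Rightarrow> 'a set" where
  "N_phi G P \<phi> = {g \<in> normalizerS G P.
     restrict (\<lambda>y. \<phi> (g \<otimes>\<^bsub>G\<^esub> inv_into P \<phi> y \<otimes>\<^bsub>G\<^esub> inv\<^bsub>G\<^esub> g)) (\<phi> ` P)
       \<in> HomS G (\<phi> ` P) (\<phi> ` P)}"

definition saturated ::
  "nat \<Rightarrow> ('a,'b) monoid_scheme \<Rightarrow> ('a set \<Rightarrow> 'a set \<Rightarrow> ('a \<Rightarrow> 'a) set) \<Rightarrow> bool" where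
  "saturated p G Hom \<longleftrightarrow> fusion_system G Hom \<and>
     (\<forall>P. subgroup P G \<and> fully_normalized G Hom P \<longrightarrow>
        fully_centralized G Hom P \<and>
        sylow_card p (card (HomS G P P)) (card (Hom P P))) \<and>
     (\<forall>P. subgroup P G \<longrightarrow> (\<forall>\<phi>\<in>Hom P (carrier G).
        fully_centralized G Hom (\<phi> ` P) \<longrightarrow>
        (\<exists>\<psi>\<in>Hom (N_phi G P \<phi>) (carrier G). \<forall>x\<in>P. \<psi> x = \<phi> x)))"

definition F_centric ::
  "('a,'b) monoid_scheme \<Rightarrow> ('a set \<Rightarrow> 'a set \<Rightarrow> ('a \<Rightarrow> 'a) set) \<Rightarrow> 'a set \<Rightarrow> bool" where
  "F_centric G Hom P \<longleftrightarrow> subgroup P G \<and>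
     (\<forall>P'. subgroup P' G \<and> F_conj Hom P P' \<longrightarrow> centralizerS G P' \<subseteq> P')"

text \<open>A centric linking system: a category with objects the F-centric subgroups,
  morphism sets Mor P Q, composition cmp P Q R g f (f : P -> Q, g : Q -> R),
  identities ide P, a functor pi to F^c (identity on objects), and monomorphisms
  delta P : P -> Aut_L(P), satisfying (A), (B), (C).\<close>
definition linking_system ::
  "('a,'b) monoid_scheme \<Rightarrow> ('a set \<Rightarrow> 'a set \<Rightarrow> ('a \<Rightarrow> 'a) set) \<Rightarrow>
   ('a set \<Rightarrow> 'a set \<Rightarrow> 'm set) \<Rightarrow> ('a set \<Rightarrow> 'a set \<Rightarrow> 'a set \<Rightarrow> 'm \<Rightarrow> 'm \<Rightarrow> 'm) \<Rightarrow>
   ('a set \<Rightarrow> 'm) \<Rightarrow> ('a set \<Rightarrow> 'a set \<Rightarrow> 'm \<Rightarrow> ('a \<Rightarrow> 'a)) \<Rightarrow> ('a set \<Rightarrow> 'a \<Rightarrow> 'm) \<Rightarrow> bool" where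
  "linking_system G Hom Mor cmp ide \<pi> \<delta> \<longleftrightarrow>
     \<comment> \<open>category axioms on the F-centric subgroups\<close>
     (\<forall>P Q R. F_centric G Hom P \<and> F_centric G Hom Q \<and> F_centric G Hom R \<longrightarrow>
        (\<forall>f\<in>Mor P Q. \<forall>g\<in>Mor Q R. cmp P Q R g f \<in> Mor P R)) \<and>
     (\<forall>P Q R T. F_centric G Hom P \<and> F_centric G Hom Q \<and> F_centric G Hom R \<and> F_centric G Hom T \<longrightarrow>
        (\<forall>f\<in>Mor P Q. \<forall>g\<in>Mor Q R. \<forall>h\<in>Mor R T.
           cmp P R T h (cmp P Q R g f) = cmp P Q T (cmp Q R T h g) f)) \<and>
     (\<forall>P. F_centric G Hom P \<longrightarrow> ide P \<in> Mor P P) \<and>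
     (\<forall>P Q. F_centric G Hom P \<and> F_centric G Hom Q \<longrightarrow>
        (\<forall>f\<in>Mor P Q. cmp P Q Q (ide Q) f = f \<and> cmp P P Q f (ide P) = f)) \<and>
     \<comment> \<open>pi is a functor to F^c which is the identity on objects\<close>
     (\<forall>P Q. F_centric G Hom P \<and> F_centric G Hom Q \<longrightarrow> (\<forall>f\<in>Mor P Q. \<pi> P Q f \<in> Hom P Q)) \<and>
     (\<forall>P. F_centric G Hom P \<longrightarrow> \<pi> P P (ide P) = restrict id P) \<and>
     (\<forall>P Q R. F_centric G Hom P \<and> F_centric G Hom Q \<and> F_centric G Hom R \<longrightarrow>
        (\<forall>f\<in>Mor P Q. \<forall>g\<in>Mor Q R.
           \<pi> P R (cmp P Q R g f) = compose P (\<pi> Q R g) (\<pi> P Q f))) \<and>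
     \<comment> \<open>delta P is a monomorphism of groups P -> Aut_L(P)\<close>
     (\<forall>P. F_centric G Hom P \<longrightarrow>
        (\<forall>g\<in>P. \<delta> P g \<in> Mor P P) \<and> \<delta> P \<one>\<^bsub>G\<^esub> = ide P \<and>
        (\<forall>g\<in>P. \<forall>h\<in>P. \<delta> P (g \<otimes>\<^bsub>G\<^esub> h) = cmp P P P (\<delta> P g) (\<delta> P h)) \<and>
        inj_on (\<delta> P) P) \<and>
     \<comment> \<open>(A)\<close>
     (\<forall>P Q. F_centric G Hom P \<and> F_centric G Hom Q \<longrightarrow>
        (\<forall>f\<in>Mor P Q. \<forall>z\<in>center_of G P. cmp P P Q f (\<delta> P z) = f \<longrightarrow> z = \<one>\<^bsub>G\<^esub>) \<and>
        \<pi> P Q ` Mor P Q = Hom P Q \<and>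
        (\<forall>f\<in>Mor P Q. \<forall>f'\<in>Mor P Q.
           \<pi> P Q f = \<pi> P Q f' \<longleftrightarrow> (\<exists>z\<in>center_of G P. f' = cmp P P Q f (\<delta> P z)))) \<and>
     \<comment> \<open>(B)\<close>
     (\<forall>P. F_centric G Hom P \<longrightarrow> (\<forall>g\<in>P. \<pi> P P (\<delta> P g) = cmap G g P)) \<and>
     \<comment> \<open>(C)\<close>
     (\<forall>P Q. F_centric G Hom P \<and> F_centric G Hom Q \<longrightarrow>
        (\<forall>f\<in>Mor P Q. \<forall>g\<in>P.
           cmp P P Q f (\<delta> P g) = cmp P Q Q (\<delta> Q (\<pi> P Q f g)) f))"

definition p_group :: "nat \<Rightarrow> ('a,'b) monoid_scheme \<Rightarrow> bool" where
  "p_group p G \<longleftrightarrow> group G \<and> finite (carrier G) \<and> (\<exists>k. card (carrier G) = p ^ k)"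

definition nilpotent_fs ::
  "('a,'b) monoid_scheme \<Rightarrow> ('a set \<Rightarrow> 'a set \<Rightarrow> ('a \<Rightarrow> 'a) set) \<Rightarrow> bool" where
  "nilpotent_fs G Hom \<longleftrightarrow>
     (\<forall>P Q. subgroup P G \<and> subgroup Q G \<longrightarrow> Hom P Q = HomS G P Q)"

definition elementary_abelian :: "nat \<Rightarrow> ('a,'b) monoid_scheme \<Rightarrow> 'a set \<Rightarrow> bool" where
  "elementary_abelian p G V \<longleftrightarrow> subgroup V G \<and>
     (\<forall>x\<in>V. \<forall>y\<in>V. x \<otimes>\<^bsub>G\<^esub> y = y \<otimes>\<^bsub>G\<^esub> x) \<and> (\<forall>x\<in>V. x [^]\<^bsub>G\<^esub> p = \<one>\<^bsub>G\<^esub>)"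

definition weakly_closed ::
  "('a,'b) monoid_scheme \<Rightarrow> ('a set \<Rightarrow> 'a set \<Rightarrow> ('a \<Rightarrow> 'a) set) \<Rightarrow> 'a set \<Rightarrow> bool" where
  "weakly_closed G Hom V \<longleftrightarrow> (\<forall>V'. subgroup V' G \<and> F_conj Hom V V' \<longrightarrow> V' = V)"

end

(* Let A be maximal among the normal elementary abelian subgroups of S. For p odd, if x and y
   centralize A and x^p = y^p, then inv x * y lies in A. Hence, for A <= Q, an automorphism of Q that
   is the identity on A has p-power order, and since A is weakly closed and Aut_F(A) is a p-group,
   Aut_F(Q) is a p-group.

   Prove Hom_F(P,S) = Hom_S(P,S) by downward induction on |P|. For Q fully normalized, first
   Aut_F(Q) = Aut_S(Q): if A <= Q this is the previous remark and the Sylow axiom. Otherwise let Z_i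
   be the upper central series of S and pick i with V = A Int Z_i contained in Q but A Int Z_(i+1)
   not. Some g in A Int Z_(i+1) outside Q normalizes Q and centralizes both V and Q/V. The
   automorphisms doing the latter form a normal p-subgroup of Aut_F(Q) because V is weakly closed, so
   every F-automorphism of Q extends over g and is conjugation by an element of S by induction.
   Consequently any F-isomorphism from P onto a fully normalized Q extends to the normalizer of P, which
   is larger than P, and is again conjugation by an element of S. *)
theory Submission
  imports Defs
begin

section \<open>Finite p-groups\<close>

text \<open>Oddness of p enters through the exponent p(p-1)/2 that the commutator acquires in the
  p-th power of a product in class two. The quaternion group of order 8 shows what goes wrong at p =
  2: there A is the centre, all elements of order 4 have the same square, and an automorphism of
  order 3 is the identity on A.

  The obstacle in the induction is that condition (II) extends a morphism only to N_phi, which may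
  be no larger than its domain. For an automorphism \<alpha> of Q one needs some g outside Q whose
  conjugation map c_g is carried by \<alpha> to a map again induced by S. Placing c_g in a normal
  p-subgroup of Aut_F(Q) achieves this for all \<alpha> at once: its conjugates stay in that
  subgroup, and a normal p-subgroup lies in every Sylow p-subgroup, hence in Aut_S(Q). For
  isomorphisms from P onto Q the difficulty disappears once Aut_F(Q) = Aut_S(Q), since then every
  element normalizing P belongs to N_phi.\<close>

lemma (in group) l_inv_cancel:
  "x \<in> carrier G \<Longrightarrow> y \<in> carrier G \<Longrightarrow> inv x \<otimes> (x \<otimes> y) = y"
  by (simp flip: m_assoc)

lemma (in group) r_inv_cancel:
  "x \<in> carrier G \<Longrightarrow> y \<in> carrier G \<Longrightarrow> x \<otimes> (inv x \<otimes> y) = y"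
  by (simp flip: m_assoc)

text \<open>Reassociating to the right hides a cancelling pair that stands in front of a longer
  word; the two cancellation rules recover it. The commutator identities below are checked by
  \<open>simp\<close> with this set.\<close>

lemmas (in group) word_simps = m_assoc inv_mult_group l_inv_cancel r_inv_cancel

lemma (in group) conj_nat_pow:
  assumes "x \<in> carrier G" "g \<in> carrier G"
  shows "(inv g \<otimes> x \<otimes> g) [^] (n::nat) = inv g \<otimes> x [^] n \<otimes> g"
  by (induction n) (use assms in \<open>simp_all add: word_simps\<close>)

text \<open>The class equation: conjugation orbits have p-power size, and an orbit of size 1 belongs
  to a central element. If \<open>\<one>\<close> were the only one, the order of G would be 1 modulo
  p.\<close>

lemma (in group) prime_power_order_imp_central:
  fixes p :: nat
  assumes p: "Factorial_Ring.prime p" and fin: "finite (carrier G)"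
    and ord: "card (carrier G) = p ^ k" and nontriv: "card (carrier G) \<noteq> 1"
  shows "\<exists>z\<in>carrier G. z \<noteq> \<one> \<and> (\<forall>g\<in>carrier G. z \<otimes> g = g \<otimes> z)"
proof (rule ccontr)
  assume no: "\<not> ?thesis"
  define \<phi> where "\<phi> = (\<lambda>g. \<lambda>h \<in> carrier G. g \<otimes> h \<otimes> inv g)"
  interpret act: group_action G "carrier G" \<phi>
    unfolding \<phi>_def by (rule action_by_conjugation)
  have dvd: "card (orbit G \<phi> x) dvd p ^ k" if "x \<in> carrier G" for x
    by (rule dvdI) (rule act.orbit_stabilizer_theorem[OF that, unfolded order_def ord, symmetric])
  have orb1: "orbit G \<phi> \<one> = {\<one>}"
    unfolding orbit_def \<phi>_def by (auto intro!: exI[of _ \<one>])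
  have big: "p dvd card (orbit G \<phi> x)" if x: "x \<in> carrier G" "x \<noteq> \<one>" for x
  proof -
    have "card (orbit G \<phi> x) \<noteq> 1"
    proof
      assume "card (orbit G \<phi> x) = 1"
      moreover have "x \<in> orbit G \<phi> x"
        using act.orbit_refl x by blast
      ultimately have orb: "orbit G \<phi> x = {x}"
        by (metis card_1_singletonE singletonD)
      have "x \<otimes> g = g \<otimes> x" if g: "g \<in> carrier G" for g
      proof -
        have "\<phi> g x \<in> orbit G \<phi> x"
          using g unfolding orbit_def by blast
        then have "g \<otimes> x \<otimes> inv g = x"
          using orb x by (simp add: \<phi>_def)
        then show ?thesis
          using g x by (metis inv_solve_right' m_closed)
      qed
      then show False
        using no x by blast
    qed
    moreover obtain i where "card (orbit G \<phi> x) = p ^ i"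
      using dvd[OF x(1)] divides_primepow_nat[OF p] by blast
    ultimately show ?thesis
      by (cases i) auto
  qed
  let ?O = "orbits G (carrier G) \<phi>"
  have finO: "finite ?O"
    using fin unfolding orbits_def by (simp add: Setcompr_eq_image)
  have one_in: "{\<one>} \<in> ?O"
    using orb1 unfolding orbits_def by blast
  have "card (carrier G) = (\<Sum>orb\<in>?O. card orb)"
    using act.disjoint_sum[OF fin, of "\<lambda>_. 1::nat"] by simp
  also have "\<dots> = 1 + (\<Sum>orb\<in>?O - {{\<one>}}. card orb)"
    using sum.remove[OF finO one_in, of card] by simp
  finally have eq: "card (carrier G) = 1 + (\<Sum>orb\<in>?O - {{\<one>}}. card orb)" .
  have "p dvd (\<Sum>orb\<in>?O - {{\<one>}}. card orb)"
  proof (rule dvd_sum)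
    fix orb assume "orb \<in> ?O - {{\<one>}}"
    then obtain x where "x \<in> carrier G" "orb = orbit G \<phi> x" "x \<noteq> \<one>"
      using orb1 unfolding orbits_def by blast
    then show "p dvd card orb"
      using big by simp
  qed
  moreover have "p dvd card (carrier G)"
    using ord nontriv by (cases k) auto
  ultimately have "p dvd 1"
    using eq by (metis dvd_add_left_iff)
  then show False
    using p not_prime_unit by blast
qed

section \<open>The upper central series\<close>

text \<open>The commutator condition describes the preimage of the centre of the quotient by the
  previous term, stated inside G so that no tower of quotients is needed.\<close>

fun upper_central :: "('a,'b) monoid_scheme \<Rightarrow> nat \<Rightarrow> 'a set" where
  "upper_central G 0 = {\<one>\<^bsub>G\<^esub>}"
| "upper_central G (Suc n) = {x \<in> carrier G.
     \<forall>g\<in>carrier G. inv\<^bsub>G\<^esub> x \<otimes>\<^bsub>G\<^esub> (inv\<^bsub>G\<^esub> g \<otimes>\<^bsub>G\<^esub> x \<otimes>\<^bsub>G\<^esub> g) \<in> upper_central G n}"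

declare upper_central.simps(2) [simp del]

lemma (in group) upper_central_SucI:
  assumes "x \<in> carrier G"
    and "\<And>g. g \<in> carrier G \<Longrightarrow> inv x \<otimes> (inv g \<otimes> x \<otimes> g) \<in> upper_central G n"
  shows "x \<in> upper_central G (Suc n)"
  using assms by (simp add: upper_central.simps(2))

lemma (in group) upper_central_SucD:
  assumes "x \<in> upper_central G (Suc n)"
  shows "x \<in> carrier G"
    and "g \<in> carrier G \<Longrightarrow> inv x \<otimes> (inv g \<otimes> x \<otimes> g) \<in> upper_central G n"
  using assms by (simp_all add: upper_central.simps(2))

text \<open>With [x,g] = x^-1 g^-1 x g, the closure properties come from [x^-1,g] = x [x,g]^-1 x^-1,
  [xy,g] = y^-1 [x,g] y [y,g] and [hxh^-1,g] = h [x, h^-1 g h] h^-1, using that the previous term is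
  normal.\<close>

lemma (in group) normal_upper_central: "upper_central G n \<lhd> G"
proof (induction n)
  case 0
  then show ?case by (simp add: one_is_normal)
next
  case (Suc n)
  define Z where "Z = upper_central G n"
  define Y where "Y = upper_central G (Suc n)"
  interpret Z: normal Z G using Suc by (simp add: Z_def)
  note YI = upper_central_SucI[of _ n, folded Y_def Z_def]
  note YD = upper_central_SucD[of _ n, folded Y_def Z_def]
  have "subgroup Y G"
  proof (rule subgroupI)
    show "Y \<subseteq> carrier G" using YD(1) by (rule subsetI)
    have "\<one> \<in> Y" by (rule YI) simp_all
    then show "Y \<noteq> {}" by blast
  next
    fix x assume x: "x \<in> Y"
    note xc = YD(1)[OF x]
    show "inv x \<in> Y"
    proof (rule YI)
      show "inv x \<in> carrier G" using xc by simp
      fix g assume g: "g \<in> carrier G"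
      have "x \<otimes> inv (inv x \<otimes> (inv g \<otimes> x \<otimes> g)) \<otimes> inv x \<in> Z"
        by (intro Z.inv_op_closed2 Z.m_inv_closed YD(2) x xc g)
      then show "inv (inv x) \<otimes> (inv g \<otimes> inv x \<otimes> g) \<in> Z"
        using xc g by (simp add: word_simps)
    qed
  next
    fix x y assume x: "x \<in> Y" and y: "y \<in> Y"
    note xc = YD(1)[OF x] and yc = YD(1)[OF y]
    show "x \<otimes> y \<in> Y"
    proof (rule YI)
      show "x \<otimes> y \<in> carrier G" using xc yc by simp
      fix g assume g: "g \<in> carrier G"
      have "inv y \<otimes> (inv x \<otimes> (inv g \<otimes> x \<otimes> g)) \<otimes> y \<otimes> (inv y \<otimes> (inv g \<otimes> y \<otimes> g)) \<in> Z"
        by (rule Z.m_closed[OF Z.inv_op_closed1[OF yc YD(2)[OF x g]] YD(2)[OF y g]])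
      then show "inv (x \<otimes> y) \<otimes> (inv g \<otimes> (x \<otimes> y) \<otimes> g) \<in> Z"
        using xc yc g by (simp add: word_simps)
    qed
  qed
  moreover have "h \<otimes> x \<otimes> inv h \<in> Y" if h: "h \<in> carrier G" and x: "x \<in> Y" for h x
  proof (rule YI)
    note xc = YD(1)[OF x]
    show "h \<otimes> x \<otimes> inv h \<in> carrier G" using xc h by simp
    fix g assume g: "g \<in> carrier G"
    have "inv h \<otimes> g \<otimes> h \<in> carrier G" using g h by simp
    then have "h \<otimes> (inv x \<otimes> (inv (inv h \<otimes> g \<otimes> h) \<otimes> x \<otimes> (inv h \<otimes> g \<otimes> h))) \<otimes> inv h \<in> Z"
      by (intro Z.inv_op_closed2[OF h] YD(2)[OF x])
    then show "inv (h \<otimes> x \<otimes> inv h) \<otimes> (inv g \<otimes> (h \<otimes> x \<otimes> inv h) \<otimes> g) \<in> Z"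
      using xc h g by (simp add: word_simps)
  qed
  ultimately have "Y \<lhd> G"
    by (simp add: normal_inv_iff)
  then show ?case by (simp add: Y_def)
qed

lemma (in group) upper_central_subset: "upper_central G n \<subseteq> carrier G"
  using normal_upper_central normal_imp_subgroup subgroup.subset by blast

lemma (in group) upper_central_mono_Suc: "upper_central G n \<subseteq> upper_central G (Suc n)"
proof
  interpret Z: normal "upper_central G n" G by (rule normal_upper_central)
  fix x assume "x \<in> upper_central G n"
  then show "x \<in> upper_central G (Suc n)"
    by (intro upper_central_SucI Z.m_closed Z.m_inv_closed Z.inv_op_closed1) simp_all
qed

text \<open>The quotient by a term of the series has nontrivial centre, so the series grows until it
  exhausts the group.\<close>

lemma (in group) upper_central_exhausts:
  fixes p :: nat
  assumes p: "Factorial_Ring.prime p" and fin: "finite (carrier G)" and ord: "card (carrier G) = p ^ k"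
  shows "\<exists>n. upper_central G n = carrier G"
proof (rule ccontr)
  assume no: "\<not> ?thesis"
  have grow: "upper_central G n \<subset> upper_central G (Suc n)" for n
  proof -
    let ?N = "upper_central G n"
    interpret N: normal ?N G by (rule normal_upper_central)
    interpret Q: group "G Mod ?N" by (rule N.factorgroup_is_group)
    have card_mult: "card (rcosets ?N) * card ?N = p ^ k"
      using lagrange[OF N.subgroup_axioms] ord by (simp add: order_def)
    then obtain j where j: "card (rcosets ?N) = p ^ j"
      using divides_primepow_nat[OF p] dvd_triv_left by metis
    have "card (rcosets ?N) \<noteq> 1"
    proof
      assume "card (rcosets ?N) = 1"
      then have "card ?N = card (carrier G)"
        using card_mult ord by simp
      then have "?N = carrier G"
        using card_subset_eq[OF fin] N.subset by blast
      then show False using no by blast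
    qed
    moreover have "finite (rcosets ?N)"
      using fin by (simp add: RCOSETS_def)
    ultimately obtain z where z: "z \<in> rcosets ?N" "z \<noteq> ?N"
      and comm: "\<And>g. g \<in> rcosets ?N \<Longrightarrow> z <#> g = g <#> z"
      using Q.prime_power_order_imp_central[OF p, of j] j by (auto simp: FactGroup_def)
    from z(1) obtain x where x: "x \<in> carrier G" "z = ?N #> x"
      by (auto simp: RCOSETS_def)
    have "x \<notin> ?N"
      using x z(2) N.rcos_const by blast
    moreover have "x \<in> upper_central G (Suc n)"
    proof (rule upper_central_SucI[OF x(1)])
      fix g assume g: "g \<in> carrier G"
      \<comment> \<open>As z is central in the quotient, x g and g x lie in the same coset; the
        factor m by which they differ is a conjugate of the commutator of x and g.\<close>
      have "?N #> g \<in> rcosets ?N"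
        using g by (simp add: rcosetsI N.subset)
      then have "?N #> (x \<otimes> g) = ?N #> (g \<otimes> x)"
        using comm[of "?N #> g"] x g by (simp add: N.rcos_sum)
      then have "x \<otimes> g \<in> ?N #> (g \<otimes> x)"
        using x g rcos_self[OF _ N.subgroup_axioms, of "x \<otimes> g"] by simp
      then obtain m where m: "m \<in> ?N" "x \<otimes> g = m \<otimes> (g \<otimes> x)"
        by (auto simp: r_coset_def)
      have "inv x \<otimes> (inv g \<otimes> x \<otimes> g) = inv (g \<otimes> x) \<otimes> m \<otimes> (g \<otimes> x)"
        using x g m by (simp add: word_simps)
      also have "\<dots> \<in> ?N"
        using x g m by (simp add: N.inv_op_closed1)
      finally show "inv x \<otimes> (inv g \<otimes> x \<otimes> g) \<in> ?N" .
    qed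
    ultimately show ?thesis
      using upper_central_mono_Suc by blast
  qed
  have "n \<le> card (upper_central G n)" for n
  proof (induction n)
    case (Suc n)
    have "card (upper_central G n) < card (upper_central G (Suc n))"
      using grow finite_subset[OF upper_central_subset fin] psubset_card_mono by blast
    with Suc show ?case by simp
  qed simp
  moreover have "card (upper_central G n) \<le> card (carrier G)" for n
    using upper_central_subset fin card_mono by blast
  ultimately show False
    by (meson Suc_n_not_le_n le_trans)
qed

section \<open>Groups of p-elements and normal p-subgroups\<close>

text \<open>Cauchy's theorem, taken from Sylow's with exponent 1: another prime divisor q of the
  order gives a subgroup of order q, whose elements have order dividing both q and a power of
  p.\<close>

lemma (in group) prime_order_elements_imp_prime_power:
  fixes p :: nat
  assumes p: "Factorial_Ring.prime p" and fin: "finite (carrier G)"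
    and pow: "\<And>x. x \<in> carrier G \<Longrightarrow> \<exists>n. x [^] (p ^ n) = \<one>"
  shows "\<exists>k. card (carrier G) = p ^ k"
proof (rule ccontr)
  assume no: "\<not> ?thesis"
  have pos: "card (carrier G) > 0"
    using fin by (simp add: card_gt_0_iff carrier_not_empty)
  have "\<exists>q. Factorial_Ring.prime q \<and> q dvd card (carrier G) \<and> q \<noteq> p"
  proof -
    obtain c where c: "card (carrier G) = p ^ multiplicity p (card (carrier G)) * c" "\<not> p dvd c"
      using multiplicity_decompose'[of "card (carrier G)" p] pos p not_prime_unit by blast
    then have "c \<noteq> 1"
      using no by (metis mult.right_neutral)
    then obtain q where "Factorial_Ring.prime q" "q dvd c"
      using prime_factor_nat by blast
    then show ?thesis
      using c by (metis dvd_mult)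
  qed
  then obtain q where q: "Factorial_Ring.prime q" "q dvd card (carrier G)" "q \<noteq> p"
    by blast
  then obtain m where m: "card (carrier G) = q ^ 1 * m"
    by auto
  obtain H where H: "subgroup H G" "card H = q"
    using sylow_thm[OF q(1) is_group, of 1 m] m fin by (auto simp: order_def)
  interpret H: subgroup H G by (rule H)
  have "H \<noteq> {\<one>}"
    using H(2) q(1) by auto
  then obtain x where x: "x \<in> H" "x \<noteq> \<one>"
    using H.one_closed by blast
  then have xc: "x \<in> carrier G" by simp
  interpret HG: group "G\<lparr>carrier := H\<rparr>" by (rule subgroup_imp_group[OF H(1)])
  have "x [^]\<^bsub>G\<lparr>carrier := H\<rparr>\<^esub> q = \<one>"
    using HG.pow_order_eq_1[of x] x H(2) by (simp add: order_def)
  then have "x [^] q = \<one>"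
    by (simp flip: nat_pow_consistent)
  then have "ord x dvd q"
    using xc pow_eq_id by blast
  moreover obtain n where "x [^] (p ^ n) = \<one>"
    using pow xc by blast
  then have "ord x dvd p ^ n"
    using xc pow_eq_id by blast
  moreover have "coprime q (p ^ n)"
    using q p by (simp add: primes_coprime)
  ultimately have "ord x = 1"
    by (meson coprime_common_divisor_nat)
  then show False
    using x xc ord_eq_1 by blast
qed

text \<open>The product of D and P is again a p-group, so it cannot be larger than the Sylow
  subgroup P. Its elements have p-power order because \<open>(d \<otimes> y) [^] n\<close> lies in
  the coset of \<open>y [^] n\<close> modulo D: raising to the power |P| lands in D.\<close>

lemma (in group) normal_p_subset_sylow:
  fixes p :: nat
  assumes p: "Factorial_Ring.prime p" and fin: "finite (carrier G)"
    and P: "subgroup P G" "sylow_card p (card P) (card (carrier G))"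
    and D: "D \<lhd> G" "\<And>x. x \<in> D \<Longrightarrow> \<exists>n. x [^] (p ^ n) = \<one>"
  shows "D \<subseteq> P"
proof -
  interpret D: normal D G by (rule D)
  interpret P: subgroup P G by (rule P)
  let ?H = "D <#> P"
  have H: "subgroup ?H G"
    by (rule mult_norm_subgroup[OF D(1) P(1)])
  interpret H: subgroup ?H G by (rule H)
  interpret HG: group "G\<lparr>carrier := ?H\<rparr>" by (rule subgroup_imp_group[OF H])
  obtain k where k: "card P = p ^ k" "p ^ k dvd card (carrier G)" "\<not> p ^ Suc k dvd card (carrier G)"
    using P(2) unfolding sylow_card_def by blast
  have P1: "y [^] card P = \<one>" if "y \<in> P" for y
  proof -
    interpret PG: group "G\<lparr>carrier := P\<rparr>" by (rule subgroup_imp_group[OF P(1)])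
    have "y [^]\<^bsub>G\<lparr>carrier := P\<rparr>\<^esub> card P = \<one>"
      using PG.pow_order_eq_1[of y] that by (simp add: order_def)
    then show ?thesis by (simp flip: nat_pow_consistent)
  qed
  have DP: "\<exists>d'\<in>D. (d \<otimes> y) [^] n = d' \<otimes> y [^] n" if "d \<in> D" "y \<in> P" for d y and n :: nat
  proof (induction n)
    case 0
    then show ?case using that by (auto intro!: bexI[of _ \<one>])
  next
    case (Suc n)
    then obtain d' where d': "d' \<in> D" "(d \<otimes> y) [^] n = d' \<otimes> y [^] n" by blast
    have "d' \<otimes> (y [^] n \<otimes> d \<otimes> inv (y [^] n)) \<in> D"
      by (rule D.m_closed[OF d'(1) D.inv_op_closed2]) (use that in auto)
    moreover have "(d \<otimes> y) [^] Suc n = d' \<otimes> (y [^] n \<otimes> d \<otimes> inv (y [^] n)) \<otimes> y [^] Suc n"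
      using d' that by (simp add: word_simps)
    ultimately show ?case by blast
  qed
  have "\<exists>n. h [^]\<^bsub>G\<lparr>carrier := ?H\<rparr>\<^esub> (p ^ n) = \<one>" if "h \<in> ?H" for h
  proof -
    obtain d y where dy: "d \<in> D" "y \<in> P" "h = d \<otimes> y"
      using \<open>h \<in> ?H\<close> by (auto simp: set_mult_def)
    obtain d' where d': "d' \<in> D" "h [^] (p ^ k) = d' \<otimes> y [^] (p ^ k)"
      using DP dy by blast
    then have "h [^] (p ^ k) = d'"
      using P1 dy k by (simp add: d')
    moreover obtain n where "d' [^] (p ^ n) = \<one>"
      using D(2) d' by blast
    ultimately have "h [^] (p ^ (k + n)) = \<one>"
      using dy by (metis D.mem_carrier P.mem_carrier m_closed nat_pow_pow power_add)
    then show ?thesis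
      by (auto simp flip: nat_pow_consistent)
  qed
  then obtain m where m: "card ?H = p ^ m"
    using HG.prime_order_elements_imp_prime_power[OF p] finite_subset[OF H.subset fin] by auto
  have "card ?H dvd card (carrier G)"
    using lagrange[OF H] by (metis dvd_triv_right order_def)
  then have "m \<le> k"
    using k m by (metis dvd_trans le_imp_power_dvd not_less_eq_eq)
  then have "card ?H \<le> card P"
    using k m p by (simp add: prime_gt_0_nat power_increasing Suc_leI)
  moreover have "P \<subseteq> ?H"
  proof
    fix y assume y: "y \<in> P"
    then have "\<one> \<otimes> y \<in> ?H"
      unfolding set_mult_def using D.one_closed by blast
    then show "y \<in> ?H" using y by simp
  qed
  ultimately have "P = ?H"
    using finite_subset[OF H.subset fin] card_seteq by blast
  moreover have "D \<subseteq> ?H"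
  proof
    fix d assume d: "d \<in> D"
    then have "d \<otimes> \<one> \<in> ?H"
      unfolding set_mult_def using P.one_closed by blast
    then show "d \<in> ?H" using d by simp
  qed
  ultimately show ?thesis by simp
qed

section \<open>Maximal normal elementary abelian subgroups\<close>

lemma (in group) subgroup_nat_pow_closed:
  fixes n :: nat
  assumes "subgroup H G" "x \<in> H"
  shows "x [^] n \<in> H"
  by (metis assms int_pow_int subgroup_int_pow_closed)

section \<open>Powers of products in class two\<close>

text \<open>Collection of factors: in going from exponent i to i + 1 the new x passes
  \<open>y [^] i\<close> and leaves \<open>c [^] i\<close> behind, which adds up to 0 + ... + (n -
  1).\<close>

lemma (in group) pow_mult_class_two:
  fixes n :: nat
  assumes x: "x \<in> carrier G" and y: "y \<in> carrier G" and c: "c \<in> carrier G"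
    and yx: "y \<otimes> x = x \<otimes> y \<otimes> c" and cx: "c \<otimes> x = x \<otimes> c" and cy: "c \<otimes> y = y \<otimes> c"
  shows "(x \<otimes> y) [^] n = x [^] n \<otimes> y [^] n \<otimes> c [^] (\<Sum>{..<n})"
proof (induction n)
  case 0
  then show ?case by simp
next
  case (Suc n)
  let ?s = "\<Sum>{..<n}"
  have yn: "y [^] n \<otimes> x = x \<otimes> (y [^] n \<otimes> c [^] n)" for n :: nat
  proof (induction n)
    case 0
    then show ?case using x by simp
  next
    case (Suc n)
    have cn: "c [^] n \<otimes> y = y \<otimes> c [^] n"
      by (rule group_commutes_pow[OF cy c y])
    have "y [^] Suc n \<otimes> x = y [^] n \<otimes> (x \<otimes> (y \<otimes> c))"
      using x y c yx by (simp add: m_assoc)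
    also have "\<dots> = (y [^] n \<otimes> x) \<otimes> (y \<otimes> c)"
      using x y c by (simp add: m_assoc)
    also have "\<dots> = x \<otimes> (y [^] n \<otimes> ((c [^] n \<otimes> y) \<otimes> c))"
      using x y c Suc by (simp add: m_assoc)
    also have "\<dots> = x \<otimes> (y [^] Suc n \<otimes> c [^] Suc n)"
      using x y c by (simp add: cn m_assoc)
    finally show ?case .
  qed
  have cs: "c [^] ?s \<otimes> (x \<otimes> y) = (x \<otimes> y) \<otimes> c [^] ?s"
    by (rule group_commutes_pow) (use x y c cx cy in \<open>simp_all flip: m_assoc\<close>, simp add: m_assoc)
  have cn: "c [^] n \<otimes> y = y \<otimes> c [^] n"
    by (rule group_commutes_pow[OF cy c y])
  have "(x \<otimes> y) [^] Suc n = x [^] n \<otimes> (y [^] n \<otimes> (c [^] ?s \<otimes> (x \<otimes> y)))"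
    using x y c Suc by (simp add: m_assoc)
  also have "\<dots> = x [^] n \<otimes> ((y [^] n \<otimes> x) \<otimes> (y \<otimes> c [^] ?s))"
    using x y c by (simp add: cs m_assoc)
  also have "\<dots> = x [^] n \<otimes> (x \<otimes> (y [^] n \<otimes> ((c [^] n \<otimes> y) \<otimes> c [^] ?s)))"
    using x y c by (simp add: yn m_assoc)
  also have "\<dots> = x [^] Suc n \<otimes> y [^] Suc n \<otimes> (c [^] n \<otimes> c [^] ?s)"
    using x y c by (simp add: cn m_assoc)
  also have "c [^] n \<otimes> c [^] ?s = c [^] (\<Sum>{..<Suc n})"
    using c by (simp add: nat_pow_mult add.commute)
  finally show ?case .
qed

text \<open>The sum is p(p-1)/2, and (p-1)/2 is an integer. At p = 2 the sum is 1, so the commutator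
  would survive in the square of a product.\<close>

lemma odd_dvd_sum_lessThan:
  fixes p :: nat
  assumes "odd p"
  shows "p dvd \<Sum>{..<p}"
proof -
  obtain k where k: "p = Suc (2 * k)"
    using assms by (auto elim: oddE)
  have "2 * \<Sum>{..<Suc n} = n * Suc n" for n :: nat
    by (induction n) auto
  from this[of "2 * k"] have "\<Sum>{..<p} = k * p"
    unfolding k by simp
  then show ?thesis by simp
qed

lemma (in group) subgroup_centralizerS:
  assumes "P \<subseteq> carrier G"
  shows "subgroup (centralizerS G P) G"
proof (rule subgroupI)
  show "centralizerS G P \<subseteq> carrier G" by (auto simp: centralizerS_def)
  have "\<one> \<in> centralizerS G P" using assms by (auto simp: centralizerS_def)
  then show "centralizerS G P \<noteq> {}" by blast
next
  fix a assume a: "a \<in> centralizerS G P"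
  then have ac: "a \<in> carrier G" by (simp add: centralizerS_def)
  have "inv a \<otimes> x = x \<otimes> inv a" if "x \<in> P" for x
  proof -
    have xc: "x \<in> carrier G" and "a \<otimes> x = x \<otimes> a" using that a assms by (auto simp: centralizerS_def)
    then have "inv a \<otimes> (a \<otimes> x) \<otimes> inv a = inv a \<otimes> (x \<otimes> a) \<otimes> inv a" by simp
    then show ?thesis using xc ac by (simp add: word_simps)
  qed
  then show "inv a \<in> centralizerS G P" using ac by (simp add: centralizerS_def)
next
  fix a b assume ab: "a \<in> centralizerS G P" "b \<in> centralizerS G P"
  then have c: "a \<in> carrier G" "b \<in> carrier G" by (auto simp: centralizerS_def)
  have "a \<otimes> b \<otimes> x = x \<otimes> (a \<otimes> b)" if x: "x \<in> P" for x
  proof -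
    have xc: "x \<in> carrier G" using x assms by auto
    moreover have "a \<otimes> x = x \<otimes> a" "b \<otimes> x = x \<otimes> b"
      using ab x by (auto simp: centralizerS_def)
    ultimately show ?thesis
      using c by (metis m_assoc)
  qed
  then show "a \<otimes> b \<in> centralizerS G P" using c by (simp add: centralizerS_def)
qed

lemma (in group) normal_centralizerS:
  assumes "N \<lhd> G"
  shows "centralizerS G N \<lhd> G"
proof -
  interpret N: normal N G by (rule assms)
  have "x \<otimes> h \<otimes> inv x \<in> centralizerS G N" if x: "x \<in> carrier G" and h: "h \<in> centralizerS G N" for x h
  proof -
    have hc: "h \<in> carrier G" using h by (simp add: centralizerS_def)
    have "x \<otimes> h \<otimes> inv x \<otimes> n = n \<otimes> (x \<otimes> h \<otimes> inv x)" if n: "n \<in> N" for n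
    proof -
      have nc: "n \<in> carrier G" using n by simp
      have "inv x \<otimes> n \<otimes> x \<in> N" using N.inv_op_closed1 x n by blast
      then have "h \<otimes> (inv x \<otimes> n \<otimes> x) = (inv x \<otimes> n \<otimes> x) \<otimes> h"
        using h by (simp add: centralizerS_def)
      then have "x \<otimes> (h \<otimes> (inv x \<otimes> n \<otimes> x)) \<otimes> inv x = x \<otimes> ((inv x \<otimes> n \<otimes> x) \<otimes> h) \<otimes> inv x" by simp
      then show ?thesis using x hc nc by (simp add: word_simps)
    qed
    then show ?thesis using x hc by (simp add: centralizerS_def)
  qed
  then show ?thesis
    using subgroup_centralizerS[OF N.subset] by (simp add: normal_inv_iff)
qed

locale max_normal_elementary_abelian = group G for G (structure) +
  fixes p :: nat and A
  assumes prime_p: "Factorial_Ring.prime p" and odd_p: "odd p"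
    and fin: "finite (carrier G)" and ord_power: "\<exists>k. card (carrier G) = p ^ k"
    and normal_A: "A \<lhd> G" and elementary_A: "elementary_abelian p G A"
    and maximal_A: "\<And>B. B \<lhd> G \<Longrightarrow> elementary_abelian p G B \<Longrightarrow> A \<subseteq> B \<Longrightarrow> B = A"
begin

abbreviation "C \<equiv> centralizerS G A"

sublocale A: normal A G by (rule normal_A)

sublocale C: normal C G by (rule normal_centralizerS[OF normal_A])

lemma A_comm: "a \<in> A \<Longrightarrow> b \<in> A \<Longrightarrow> a \<otimes> b = b \<otimes> a"
  and A_pow: "a \<in> A \<Longrightarrow> a [^] p = \<one>"
  using elementary_A by (auto simp: elementary_abelian_def)

lemma C_comm: "c \<in> C \<Longrightarrow> a \<in> A \<Longrightarrow> c \<otimes> a = a \<otimes> c"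
  unfolding centralizerS_def by blast

text \<open>The subgroup generated by A and w is normal and elementary abelian, so it equals A by maximality.\<close>

lemma central_mod_A_imp_mem:
  assumes w: "w \<in> C" "w [^] p = \<one>"
    and comm: "\<And>g. g \<in> carrier G \<Longrightarrow> inv w \<otimes> (inv g \<otimes> w \<otimes> g) \<in> A"
  shows "w \<in> A"
proof -
  have wc: "w \<in> carrier G" using w by simp
  let ?B = "A <#> generate G {w}"
  have gen: "generate G {w} = {w [^] n | n. n \<in> (UNIV :: nat set)}"
    by (rule generate_pow_on_finite_carrier[OF fin wc])
  have B: "?B = {a \<otimes> w [^] n | a n. a \<in> A \<and> n \<in> (UNIV :: nat set)}"
    unfolding gen by (auto simp: set_mult_def)
  have subB: "subgroup ?B G"
    by (rule mult_norm_subgroup[OF normal_A generate_is_subgroup]) (use wc in simp)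
  have wa: "w [^] n \<otimes> a = a \<otimes> w [^] n" if "a \<in> A" for a and n :: nat
    by (rule group_commutes_pow) (use that C_comm w wc in auto)
  have "?B \<lhd> G"
    unfolding normal_inv_iff
  proof (intro conjI ballI subB)
    fix g b assume g: "g \<in> carrier G" and "b \<in> ?B"
    then obtain a and n :: nat where ab: "a \<in> A" "b = a \<otimes> w [^] n" by (auto simp: B)
    \<comment> \<open>\<open>v\<close> records how g moves w: conjugation by g sends w to
      \<open>w \<otimes> v\<close> with v in A, and v commutes with w because w centralizes A. So
      powers of w are moved by powers of v.\<close>
    define v where "v = inv w \<otimes> (inv (inv g) \<otimes> w \<otimes> inv g)"
    have v: "v \<in> A" using comm[of "inv g"] g by (simp add: v_def)
    have "g \<otimes> w [^] n \<otimes> inv g = (inv (inv g) \<otimes> w \<otimes> inv g) [^] n"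
      using conj_nat_pow[of w "inv g" n] g wc by simp
    also have "inv (inv g) \<otimes> w \<otimes> inv g = w \<otimes> v"
      using g wc by (simp add: v_def word_simps)
    also have "(w \<otimes> v) [^] n = w [^] n \<otimes> v [^] n"
      by (rule pow_mult_distrib) (use v C_comm w wc in auto)
    also have "\<dots> = v [^] n \<otimes> w [^] n"
      by (rule wa[OF subgroup_nat_pow_closed[OF A.subgroup_axioms v]])
    finally have eq: "g \<otimes> w [^] n \<otimes> inv g = v [^] n \<otimes> w [^] n" .
    have "g \<otimes> b \<otimes> inv g = (g \<otimes> a \<otimes> inv g) \<otimes> (g \<otimes> w [^] n \<otimes> inv g)"
      using g ab wc by (simp add: word_simps)
    also have "\<dots> = (g \<otimes> a \<otimes> inv g \<otimes> v [^] n) \<otimes> w [^] n"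
      unfolding eq using g ab wc v by (simp add: word_simps)
    finally have "g \<otimes> b \<otimes> inv g = (g \<otimes> a \<otimes> inv g \<otimes> v [^] n) \<otimes> w [^] n" .
    moreover have "v [^] n \<in> A"
      by (rule subgroup_nat_pow_closed[OF A.subgroup_axioms v])
    then have "g \<otimes> a \<otimes> inv g \<otimes> v [^] n \<in> A"
      using A.inv_op_closed2 g ab by simp
    ultimately show "g \<otimes> b \<otimes> inv g \<in> ?B"
      unfolding B by blast
  qed
  moreover have "elementary_abelian p G ?B"
    unfolding elementary_abelian_def
  proof (intro conjI ballI subB)
    fix b assume "b \<in> ?B"
    then obtain a and n :: nat where ab: "a \<in> A" "b = a \<otimes> w [^] n" by (auto simp: B)
    have "b [^] p = a [^] p \<otimes> (w [^] n) [^] p"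
      unfolding ab by (rule pow_mult_distrib) (use wa ab wc in auto)
    also have "(w [^] n) [^] p = (w [^] p) [^] n"
      using wc by (simp add: nat_pow_pow mult.commute)
    finally show "b [^] p = \<one>" using ab w A_pow by simp
    fix b' assume "b' \<in> ?B"
    then obtain a' and n' :: nat where ab': "a' \<in> A" "b' = a' \<otimes> w [^] n'" by (auto simp: B)
    have "b \<otimes> b' = a \<otimes> (w [^] n \<otimes> a') \<otimes> w [^] n'"
      using ab ab' wc by (simp add: m_assoc)
    also have "\<dots> = (a \<otimes> a') \<otimes> (w [^] n \<otimes> w [^] n')"
      using ab ab' wc wa by (simp add: m_assoc)
    also have "\<dots> = (a' \<otimes> a) \<otimes> (w [^] n' \<otimes> w [^] n)"
      using ab ab' wc A_comm by (simp add: nat_pow_mult add.commute)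
    also have "\<dots> = a' \<otimes> (w [^] n' \<otimes> a) \<otimes> w [^] n"
      using ab ab' wc wa by (simp add: m_assoc)
    also have "\<dots> = b' \<otimes> b"
      using ab ab' wc by (simp add: m_assoc)
    finally show "b \<otimes> b' = b' \<otimes> b" .
  qed
  moreover have "A \<subseteq> ?B"
  proof
    fix a assume a: "a \<in> A"
    then have "a = a \<otimes> w [^] (0::nat)" by simp
    then show "a \<in> ?B" unfolding B using a by blast
  qed
  ultimately have "?B = A" by (rule maximal_A)
  moreover have "w = \<one> \<otimes> w [^] (1::nat)" using wc by simp
  then have "w \<in> ?B" unfolding B using A.one_closed by blast
  ultimately show ?thesis by simp
qed

text \<open>The commutator u of x and w satisfies the hypotheses one step lower in the series, as x u is a
  conjugate of x. So u is central in C, and x and w generate a group of class 2 in which, p being odd,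
  taking p-th powers is multiplicative.\<close>

lemma upper_central_pow_eq_imp_mem:
  assumes "x \<in> C" "w \<in> C" "w \<in> upper_central G j" "(x \<otimes> w) [^] p = x [^] p"
  shows "w \<in> A"
  using assms
proof (induction j arbitrary: x w)
  case 0
  then show ?case by simp
next
  case (Suc j)
  interpret Z: normal "upper_central G j" G by (rule normal_upper_central)
  note x = Suc.prems(1) and w = Suc.prems(2) and eq = Suc.prems(4)
  have xc: "x \<in> carrier G" and wc: "w \<in> carrier G" using x w by simp_all
  note lower = upper_central_SucD(2)[OF Suc.prems(3)]
  have conjC: "inv g \<otimes> y \<otimes> g \<in> C" if "y \<in> C" "g \<in> carrier G" for y g
    using that by (rule C.inv_op_closed1[rotated])
  define u where "u = inv x \<otimes> (inv w \<otimes> x \<otimes> w)"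
  have uA: "u \<in> A"
  proof (rule Suc.IH)
    show "x \<in> C" by (rule x)
    show "u \<in> C" unfolding u_def by (intro C.m_closed C.m_inv_closed conjC x wc)
    have "inv (inv w \<otimes> (inv x \<otimes> w \<otimes> x)) \<in> upper_central G j"
      by (intro Z.m_inv_closed lower xc)
    then show "u \<in> upper_central G j"
      using xc wc by (simp add: u_def word_simps)
    \<comment> \<open>\<open>t\<close> is a power both of x and of \<open>x \<otimes> w\<close>, so
      it commutes with w. Conjugation by w therefore fixes t while sending x to
      \<open>x \<otimes> u\<close>, which gives the equality of p-th powers for x and u.\<close>
    define t where "t = x [^] p"
    have tc: "t \<in> carrier G" using xc by (simp add: t_def)
    have "t \<otimes> x = x \<otimes> t"
      unfolding t_def by (rule group_commutes_pow) (use xc in auto)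
    moreover have "t \<otimes> (x \<otimes> w) = (x \<otimes> w) \<otimes> t"
      unfolding t_def eq[symmetric] by (rule group_commutes_pow) (use xc wc in auto)
    ultimately have "x \<otimes> (t \<otimes> w) = x \<otimes> (w \<otimes> t)"
      using xc wc tc by (metis m_assoc)
    then have tw: "t \<otimes> w = w \<otimes> t"
      using xc wc tc by (metis l_cancel m_closed)
    have "x \<otimes> u = inv w \<otimes> x \<otimes> w"
      using xc wc by (simp add: u_def word_simps)
    then have "(x \<otimes> u) [^] p = inv w \<otimes> t \<otimes> w"
      using conj_nat_pow[OF xc wc] by (simp add: t_def)
    also have "\<dots> = t"
      using tw wc tc by (simp add: word_simps)
    finally show "(x \<otimes> u) [^] p = x [^] p" by (simp add: t_def)
  qed
  have iu: "inv u \<in> A" using uA by simp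
  have wx: "w \<otimes> x = x \<otimes> w \<otimes> inv u"
    using xc wc by (simp add: u_def word_simps)
  have "(x \<otimes> w) [^] p = x [^] p \<otimes> w [^] p \<otimes> inv u [^] (\<Sum>{..<p})"
    by (rule pow_mult_class_two[OF xc wc _ wx])
      (use C_comm[OF x iu] C_comm[OF w iu] iu in simp_all)
  moreover have "inv u [^] (\<Sum>{..<p}) = \<one>"
  proof -
    obtain m where "\<Sum>{..<p} = p * m" using odd_dvd_sum_lessThan[OF odd_p] by blast
    then have "inv u [^] (\<Sum>{..<p}) = (inv u [^] p) [^] m"
      using iu A.mem_carrier nat_pow_pow by metis
    then show ?thesis using A_pow[OF iu] by simp
  qed
  ultimately have wp: "w [^] p = \<one>"
    using eq xc wc by simp
  show ?case
  proof (rule central_mod_A_imp_mem[OF w wp])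
    fix g assume g: "g \<in> carrier G"
    \<comment> \<open>Second use of the induction hypothesis, now with w in the place of x: its
      conjugate by g also has p-th power \<open>\<one>\<close>, and differs from w by a commutator
      one term lower in the series. This is why x is generalized as well.\<close>
    show "inv w \<otimes> (inv g \<otimes> w \<otimes> g) \<in> A"
    proof (rule Suc.IH)
      show "w \<in> C" by (rule w)
      show "inv w \<otimes> (inv g \<otimes> w \<otimes> g) \<in> C"
        by (intro C.m_closed C.m_inv_closed conjC w g)
      show "inv w \<otimes> (inv g \<otimes> w \<otimes> g) \<in> upper_central G j"
        by (rule lower[OF g])
      have "w \<otimes> (inv w \<otimes> (inv g \<otimes> w \<otimes> g)) = inv g \<otimes> w \<otimes> g"
        using wc g by (simp add: word_simps)
      then show "(w \<otimes> (inv w \<otimes> (inv g \<otimes> w \<otimes> g))) [^] p = w [^] p"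
        using conj_nat_pow[OF wc g] wp g by simp
    qed
  qed
qed

lemma pow_eq_imp_mem:
  assumes "x \<in> C" "w \<in> C" "(x \<otimes> w) [^] p = x [^] p"
  shows "w \<in> A"
proof -
  obtain k where "card (carrier G) = p ^ k" using ord_power by blast
  then obtain j where "upper_central G j = carrier G"
    using upper_central_exhausts[OF prime_p fin] by blast
  then show ?thesis
    using upper_central_pow_eq_imp_mem[of x w j] assms by simp
qed

end

section \<open>Iterates of endomorphisms, and those that are the identity on A\<close>

lemma (in group) endo_nat_pow:
  fixes n :: nat
  assumes Q: "subgroup Q G" and f: "f \<in> Q \<rightarrow> Q"
    and mult: "\<And>x y. x \<in> Q \<Longrightarrow> y \<in> Q \<Longrightarrow> f (x \<otimes> y) = f x \<otimes> f y" and x: "x \<in> Q"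
  shows "f (x [^] n) = f x [^] n"
proof (induction n)
  case 0
  interpret Q: subgroup Q G by (rule Q)
  have "f \<one> \<in> carrier G" using f Q.one_closed Q.mem_carrier by blast
  moreover have "f \<one> \<otimes> f \<one> = f \<one>" using mult[of \<one> \<one>] by simp
  ultimately have "f \<one> = \<one>" by simp
  then show ?case by simp
next
  case (Suc n)
  interpret Q: subgroup Q G by (rule Q)
  have "x [^] n \<in> Q" using Q x by (simp add: subgroup_nat_pow_closed)
  then show ?case using mult x Suc by simp
qed

lemma (in group) endo_funpow:
  assumes f: "f \<in> Q \<rightarrow> Q" and mult: "\<And>x y. x \<in> Q \<Longrightarrow> y \<in> Q \<Longrightarrow> f (x \<otimes> y) = f x \<otimes> f y"
  shows "f ^^ n \<in> Q \<rightarrow> Q"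
    and "\<And>x y. x \<in> Q \<Longrightarrow> y \<in> Q \<Longrightarrow> (f ^^ n) (x \<otimes> y) = (f ^^ n) x \<otimes> (f ^^ n) y"
proof -
  show 1: "f ^^ n \<in> Q \<rightarrow> Q" for n
    by (induction n) (use f in auto)
  show "(f ^^ n) (x \<otimes> y) = (f ^^ n) x \<otimes> (f ^^ n) y" if "x \<in> Q" "y \<in> Q" for x y
    by (induction n) (use 1 that mult in \<open>simp_all add: Pi_iff\<close>)
qed

text \<open>As f fixes u, each iteration contributes one more factor u, so x returns to itself once
  the power of u is trivial.\<close>

lemma (in group) endo_funpow_translate:
  assumes Q: "subgroup Q G" and f: "f \<in> Q \<rightarrow> Q"
    and mult: "\<And>x y. x \<in> Q \<Longrightarrow> y \<in> Q \<Longrightarrow> f (x \<otimes> y) = f x \<otimes> f y"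
    and x: "x \<in> Q" "u \<in> Q" "f x = x \<otimes> u" "f u = u"
  shows "(f ^^ n) x = x \<otimes> u [^] n"
proof (induction n)
  case 0
  interpret Q: subgroup Q G by (rule Q)
  show ?case using x by simp
next
  case (Suc n)
  interpret Q: subgroup Q G by (rule Q)
  have "u [^] n \<in> Q" using Q x by (simp add: subgroup_nat_pow_closed)
  then have "(f ^^ Suc n) x = x \<otimes> (u \<otimes> u [^] n)"
    using Suc x mult endo_nat_pow[OF Q f mult, of u n] by (simp add: m_assoc)
  also have "u \<otimes> u [^] n = u [^] Suc n"
    using x Q.mem_carrier nat_pow_Suc2 by metis
  finally show ?case .
qed

context max_normal_elementary_abelian
begin

text \<open>Two layers, each costing \<open>p ^ m\<close> iterations: the first makes f trivial on
  the elements of Q that centralize A, the second on all of Q. In each layer an iterate of f moves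
  an element by a factor that it already fixes, so \<open>endo_funpow_translate\<close>
  applies.\<close>

lemma endo_fixing_A_prime_power:
  assumes Q: "subgroup Q G" and AQ: "A \<subseteq> Q" and ord: "card (carrier G) = p ^ m"
    and f: "f \<in> Q \<rightarrow> Q" and mult: "\<And>x y. x \<in> Q \<Longrightarrow> y \<in> Q \<Longrightarrow> f (x \<otimes> y) = f x \<otimes> f y"
    and fix_A: "\<And>a. a \<in> A \<Longrightarrow> f a = a" and x: "x \<in> Q"
  shows "(f ^^ (p ^ m * p ^ m)) x = x"
proof -
  interpret Q: subgroup Q G by (rule Q)
  have fixn: "(f ^^ n) a = a" if "a \<in> A" for a n
    by (induction n) (use fix_A that in auto)
  note closed = endo_funpow(1)[OF f mult] and multn = endo_funpow(2)[OF f mult]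
  have pow_m: "x [^] (p ^ m) = \<one>" if "x \<in> carrier G" for x
    using pow_order_eq_1[OF that] ord by (simp add: order_def)
  \<comment> \<open>Induction on k: the iterate h fixes \<open>x [^] p\<close>, so x and
    \<open>h x\<close> centralize A and have equal p-th powers. Hence they differ by some v in A,
    and \<open>v [^] p = \<one>\<close> makes p steps of h return to x. For k = 0 the element is
    \<open>\<one>\<close>, which lies in A.\<close>
  have fixC: "(f ^^ (p ^ k)) x = x" if "x \<in> Q" "x \<in> C" "x [^] (p ^ k) = \<one>" for x k
    using that
  proof (induction k arbitrary: x)
    case 0
    then show ?case using fix_A by simp
  next
    case (Suc k)
    note xQ = Suc.prems(1) and xC = Suc.prems(2)
    have xc: "x \<in> carrier G" using xQ by simp
    define h where "h = f ^^ (p ^ k)"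
    have h: "h \<in> Q \<rightarrow> Q" "\<And>x y. x \<in> Q \<Longrightarrow> y \<in> Q \<Longrightarrow> h (x \<otimes> y) = h x \<otimes> h y"
      unfolding h_def using closed multn by blast+
    have hQ: "h x \<in> Q" using h(1) xQ by blast
    have hC: "h x \<in> C"
    proof -
      have "h x \<otimes> a = a \<otimes> h x" if a: "a \<in> A" for a
      proof -
        have "h (x \<otimes> a) = h (a \<otimes> x)" using C_comm[OF xC a] by simp
        then show ?thesis using h(2) a AQ xQ fixn[OF a] by (simp add: h_def subset_iff)
      qed
      then show ?thesis using hQ Q.mem_carrier unfolding centralizerS_def by blast
    qed
    have "x [^] p \<in> Q" "x [^] p \<in> C"
      using subgroup_nat_pow_closed[OF Q xQ] subgroup_nat_pow_closed[OF C.subgroup_axioms xC] by blast+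
    moreover have "(x [^] p) [^] (p ^ k) = \<one>"
      using Suc.prems(3) xc by (simp add: nat_pow_pow)
    ultimately have "h (x [^] p) = x [^] p"
      unfolding h_def by (rule Suc.IH)
    then have hp: "h x [^] p = x [^] p"
      using endo_nat_pow[OF Q h xQ] by simp
    define v where "v = inv x \<otimes> h x"
    have xv: "x \<otimes> v = h x"
      using xc hQ by (simp add: v_def word_simps)
    have vA: "v \<in> A"
    proof (rule pow_eq_imp_mem[OF xC])
      show "v \<in> C" unfolding v_def using xC hC by blast
      show "(x \<otimes> v) [^] p = x [^] p" by (simp add: xv hp)
    qed
    have "(h ^^ p) x = x \<otimes> v [^] p"
      by (rule endo_funpow_translate[OF Q h xQ]) (use vA AQ xv fixn in \<open>auto simp: h_def\<close>)
    also have "\<dots> = x" using A_pow[OF vA] xc by simp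
    finally have "(h ^^ p) x = x" .
    moreover have "f ^^ (p ^ Suc k) = h ^^ p"
      by (simp add: h_def funpow_mult mult.commute)
    ultimately show ?case by simp
  qed
  define h where "h = f ^^ (p ^ m)"
  have h: "h \<in> Q \<rightarrow> Q" "\<And>x y. x \<in> Q \<Longrightarrow> y \<in> Q \<Longrightarrow> h (x \<otimes> y) = h x \<otimes> h y"
    unfolding h_def using closed multn by blast+
  have xc: "x \<in> carrier G" and hQ: "h x \<in> Q" using h(1) x by auto
  define u where "u = inv x \<otimes> h x"
  have uQ: "u \<in> Q" unfolding u_def using x hQ by blast
  then have uc: "u \<in> carrier G" by simp
  have xu: "h x = x \<otimes> u"
    using xc hQ by (simp add: u_def word_simps)
  have "u \<otimes> a = a \<otimes> u" if a: "a \<in> A" for a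
  proof -
    \<comment> \<open>Since A is normal, \<open>x \<otimes> a = a' \<otimes> x\<close> with a' in A.
      Applying h, which fixes a and a', and comparing shows that the displacement u of x commutes
      with a.\<close>
    define a' where "a' = x \<otimes> a \<otimes> inv x"
    have a': "a' \<in> A" unfolding a'_def using A.inv_op_closed2 xc a by blast
    have ac: "a \<in> carrier G" "a' \<in> carrier G" using a a' by simp_all
    have xa: "x \<otimes> a = a' \<otimes> x" using xc ac by (simp add: a'_def word_simps)
    then have "h (x \<otimes> a) = h (a' \<otimes> x)" by simp
    then have "h x \<otimes> a = a' \<otimes> h x"
      using h(2) a a' AQ x fixn[OF a] fixn[OF a'] by (simp add: h_def subset_iff)
    then have "x \<otimes> (u \<otimes> a) = (a' \<otimes> x) \<otimes> u"
      using xc uc ac by (simp add: xu m_assoc)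
    also have "\<dots> = x \<otimes> (a \<otimes> u)"
      unfolding xa[symmetric] using xc uc ac by (simp add: m_assoc)
    finally show ?thesis using xc uc ac by simp
  qed
  then have uC: "u \<in> C" using uc unfolding centralizerS_def by blast
  have "h u = u"
    unfolding h_def by (rule fixC[OF uQ uC pow_m[OF uc]])
  then have "(h ^^ (p ^ m)) x = x \<otimes> u [^] (p ^ m)"
    by (intro endo_funpow_translate[OF Q h x uQ xu])
  then show ?thesis
    using pow_m[OF uc] xc by (simp add: h_def funpow_mult)
qed

end

section \<open>Fusion systems\<close>

lemma (in group) conjset_card:
  assumes "g \<in> carrier G" "P \<subseteq> carrier G"
  shows "card (conjset G g P) = card P"
proof -
  have "inj_on (\<lambda>x. g \<otimes> x \<otimes> inv g) P"
    using assms by (intro inj_onI) (auto simp: subset_iff)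
  then show ?thesis unfolding conjset_def by (rule card_image)
qed

text \<open>Finiteness: conjugation preserves cardinality, so inclusion already forces
  equality.\<close>

lemma (in group) normalizerS_I:
  assumes "finite (carrier G)" "g \<in> carrier G" "P \<subseteq> carrier G"
    and "\<And>x. x \<in> P \<Longrightarrow> g \<otimes> x \<otimes> inv g \<in> P"
  shows "g \<in> normalizerS G P"
proof -
  have "conjset G g P \<subseteq> P" using assms(4) by (auto simp: conjset_def)
  then have "conjset G g P = P"
    using card_subset_eq conjset_card[OF assms(2,3)] finite_subset[OF assms(3,1)] by blast
  then show ?thesis using assms(2) by (simp add: normalizerS_def)
qed

lemma (in group) normalizerS_D:
  assumes "g \<in> normalizerS G P"
  shows "g \<in> carrier G" and "x \<in> P \<Longrightarrow> g \<otimes> x \<otimes> inv g \<in> P"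
  using assms by (auto simp: normalizerS_def conjset_def)

text \<open>The definition constrains conjugates of g; this version says that conjugation by g moves
  any x only within its coset modulo the lower term. The element is the commutator of
  \<open>inv g\<close> and \<open>inv x\<close>, conjugated by x.\<close>

lemma (in group) upper_central_commutator:
  assumes g: "g \<in> upper_central G (Suc n)" and x: "x \<in> carrier G"
  shows "inv x \<otimes> (g \<otimes> x \<otimes> inv g) \<in> upper_central G n"
proof -
  interpret Y: normal "upper_central G (Suc n)" G by (rule normal_upper_central)
  interpret Z: normal "upper_central G n" G by (rule normal_upper_central)
  have gc: "g \<in> carrier G" using g by (rule upper_central_SucD)
  have "inv (inv g) \<otimes> (inv (inv x) \<otimes> inv g \<otimes> inv x) \<in> upper_central G n"
    by (rule upper_central_SucD(2)) (use g x Y.m_inv_closed in blast)+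
  then have "inv x \<otimes> (inv (inv g) \<otimes> (inv (inv x) \<otimes> inv g \<otimes> inv x)) \<otimes> x \<in> upper_central G n"
    using x by (intro Z.inv_op_closed1)
  then show ?thesis using x gc by (simp add: word_simps)
qed

lemma ascending_jump:
  assumes "P (0::nat)" "\<not> P n"
  shows "\<exists>i. P i \<and> \<not> P (Suc i)"
  using assms by (induction n) auto

text \<open>At the last term of the upper central series contained in P, an element g of the next
  term outside P sends each x in P to x times an element of P.\<close>

lemma (in group) proper_subgroup_normalizerS:
  fixes p :: nat
  assumes p: "Factorial_Ring.prime p" and fin: "finite (carrier G)" and ord: "card (carrier G) = p ^ k"
    and P: "subgroup P G" "P \<noteq> carrier G"
  obtains g where "g \<in> normalizerS G P" "g \<notin> P"
proof -
  interpret P: subgroup P G by (rule P)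
  obtain n where "upper_central G n = carrier G"
    using upper_central_exhausts[OF p fin ord] by blast
  then have "\<not> upper_central G n \<subseteq> P" using P P.subset by blast
  moreover have "upper_central G 0 \<subseteq> P" by simp
  ultimately obtain i where i: "upper_central G i \<subseteq> P" "\<not> upper_central G (Suc i) \<subseteq> P"
    using ascending_jump[of "\<lambda>i. upper_central G i \<subseteq> P" n] by blast
  then obtain g where g: "g \<in> upper_central G (Suc i)" "g \<notin> P" by blast
  have gc: "g \<in> carrier G" using g(1) by (rule upper_central_SucD)
  have "g \<in> normalizerS G P"
  proof (rule normalizerS_I[OF fin gc P.subset])
    fix x assume x: "x \<in> P"
    have "x \<otimes> (inv x \<otimes> (g \<otimes> x \<otimes> inv g)) \<in> P"
      by (rule P.m_closed[OF x]) (use upper_central_commutator[OF g(1), of x] i(1) x in auto)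
    then show "g \<otimes> x \<otimes> inv g \<in> P"
      using x gc by (simp add: r_inv_cancel)
  qed
  then show ?thesis using that g by blast
qed

section \<open>Morphisms, conjugacy and automorphism groups\<close>

locale p_fusion_system = group G for G (structure) +
  fixes p :: nat and Hom :: "'a set \<Rightarrow> 'a set \<Rightarrow> ('a \<Rightarrow> 'a) set"
  assumes prime_p: "Factorial_Ring.prime p" and p_grp: "p_group p G"
    and fusion: "fusion_system G Hom"
begin

lemma fin: "finite (carrier G)"
  using p_grp by (simp add: p_group_def)

lemma finite_subgroup: "subgroup P G \<Longrightarrow> finite P"
  using fin finite_subset subgroup.subset by blast

lemma HomS_subset: "subgroup P G \<Longrightarrow> subgroup Q G \<Longrightarrow> HomS G P Q \<subseteq> Hom P Q"
  and Hom_InjHom: "subgroup P G \<Longrightarrow> subgroup Q G \<Longrightarrow> Hom P Q \<subseteq> InjHom G P Q"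
  and Hom_compose: "subgroup P G \<Longrightarrow> subgroup Q G \<Longrightarrow> subgroup R G \<Longrightarrow>
      \<phi> \<in> Hom P Q \<Longrightarrow> \<psi> \<in> Hom Q R \<Longrightarrow> compose P \<psi> \<phi> \<in> Hom P R"
  and Hom_image: "subgroup P G \<Longrightarrow> subgroup Q G \<Longrightarrow> \<phi> \<in> Hom P Q \<Longrightarrow> \<phi> \<in> Hom P (\<phi> ` P)"
  and Hom_inverse: "subgroup P G \<Longrightarrow> subgroup Q G \<Longrightarrow> \<phi> \<in> Hom P Q \<Longrightarrow>
      restrict (inv_into P \<phi>) (\<phi> ` P) \<in> Hom (\<phi> ` P) P"
  using fusion unfolding fusion_system_def by blast+

lemma HomD:
  assumes "subgroup P G" "subgroup Q G" "\<phi> \<in> Hom P Q"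
  shows "\<phi> \<in> extensional P" "\<phi> \<in> P \<rightarrow> Q" "inj_on \<phi> P"
    and "\<And>x y. x \<in> P \<Longrightarrow> y \<in> P \<Longrightarrow> \<phi> (x \<otimes> y) = \<phi> x \<otimes> \<phi> y"
proof -
  have "\<phi> \<in> InjHom G P Q" using Hom_InjHom[OF assms(1,2)] assms(3) by blast
  then show "\<phi> \<in> extensional P" "\<phi> \<in> P \<rightarrow> Q" "inj_on \<phi> P"
    and "\<And>x y. x \<in> P \<Longrightarrow> y \<in> P \<Longrightarrow> \<phi> (x \<otimes> y) = \<phi> x \<otimes> \<phi> y"
    by (auto simp: InjHom_def)
qed

lemma HomS_I:
  assumes PQ: "subgroup P G" "subgroup Q G" and \<phi>: "\<phi> \<in> extensional P" "\<phi> \<in> P \<rightarrow> Q"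
    and g: "g \<in> carrier G" "\<And>x. x \<in> P \<Longrightarrow> \<phi> x = g \<otimes> x \<otimes> inv g"
  shows "\<phi> \<in> HomS G P Q"
proof -
  have "\<phi> = cmap G g P"
    unfolding cmap_def by (rule extensionalityI[OF \<phi>(1) restrict_extensional]) (simp add: g)
  moreover have "conjset G g P \<subseteq> Q"
    using g(2) \<phi>(2) by (auto simp: conjset_def Pi_iff)
  ultimately show ?thesis
    unfolding HomS_def using g(1) by blast
qed

lemma HomS_D:
  assumes "\<phi> \<in> HomS G P Q"
  shows "\<exists>g\<in>carrier G. \<forall>x\<in>P. \<phi> x = g \<otimes> x \<otimes> inv g"
  using assms by (auto simp: HomS_def cmap_def)

lemma inclusion_Hom:
  assumes "subgroup P G" "subgroup Q G" "P \<subseteq> Q"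
  shows "restrict id P \<in> Hom P Q"
proof -
  have "restrict id P \<in> HomS G P Q"
    using assms subgroup.mem_carrier[OF assms(1)] by (intro HomS_I[where g = \<one>]) auto
  then show ?thesis using HomS_subset assms by blast
qed

lemma Hom_restrict:
  assumes "subgroup R G" "subgroup P G" "subgroup Q G" "R \<subseteq> P" "\<phi> \<in> Hom P Q"
  shows "restrict \<phi> R \<in> Hom R Q"
proof -
  have "compose R \<phi> (restrict id R) = restrict \<phi> R"
    by (auto simp: compose_def)
  then show ?thesis
    using Hom_compose[OF assms(1-3) inclusion_Hom[OF assms(1,2,4)] assms(5)] by simp
qed

lemma Hom_mono:
  assumes "subgroup P G" "subgroup Q G" "subgroup R G" "Q \<subseteq> R" "\<phi> \<in> Hom P Q"
  shows "\<phi> \<in> Hom P R"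
proof -
  have "compose P (restrict id Q) \<phi> = \<phi>"
    using HomD[OF assms(1,2,5)] by (intro extensionalityI[of _ P]) (auto simp: compose_def)
  then show ?thesis
    using Hom_compose[OF assms(1-3,5) inclusion_Hom[OF assms(2,3,4)]] by simp
qed

lemma subgroup_image:
  assumes P: "subgroup P G" and Q: "subgroup Q G" and \<phi>: "\<phi> \<in> Hom P Q"
  shows "subgroup (\<phi> ` P) G"
proof -
  interpret P: subgroup P G by (rule P)
  interpret Q: subgroup Q G by (rule Q)
  have "group_hom (G\<lparr>carrier := P\<rparr>) G \<phi>"
    unfolding group_hom_def group_hom_axioms_def
    using subgroup_imp_group[OF P] is_group HomD(2,4)[OF P Q \<phi>]
    by (auto simp: hom_def Pi_iff)
  then have "subgroup (\<phi> ` carrier (G\<lparr>carrier := P\<rparr>)) G"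
    by (rule group_hom.img_is_subgroup)
  then show ?thesis by simp
qed

text \<open>Replaces the pair of mutually inverse morphisms by one surjective morphism; its inverse
  is a morphism by the factorization axiom.\<close>

lemma F_conj_iff:
  assumes P: "subgroup P G" and Q: "subgroup Q G"
  shows "F_conj Hom P Q \<longleftrightarrow> (\<exists>\<phi>\<in>Hom P Q. \<phi> ` P = Q)"
proof
  assume "F_conj Hom P Q"
  then obtain \<phi> \<psi> where \<phi>: "\<phi> \<in> Hom P Q" and \<psi>: "\<psi> \<in> Hom Q P"
    and inverse: "compose Q \<phi> \<psi> = restrict id Q"
    by (auto simp: F_conj_def)
  have "y \<in> \<phi> ` P" if "y \<in> Q" for y
  proof -
    have "\<phi> (\<psi> y) = y" using fun_cong[OF inverse, of y] that by (simp add: compose_def)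
    moreover have "\<psi> y \<in> P" using HomD(2)[OF Q P \<psi>] that by blast
    ultimately show ?thesis by (metis imageI)
  qed
  then have "\<phi> ` P = Q" using HomD(2)[OF P Q \<phi>] by blast
  then show "\<exists>\<phi>\<in>Hom P Q. \<phi> ` P = Q" using \<phi> by blast
next
  assume "\<exists>\<phi>\<in>Hom P Q. \<phi> ` P = Q"
  then obtain \<phi> where \<phi>: "\<phi> \<in> Hom P Q" "\<phi> ` P = Q" by blast
  note inj = HomD(3)[OF P Q \<phi>(1)]
  let ?\<psi> = "restrict (inv_into P \<phi>) Q"
  have "?\<psi> \<in> Hom Q P" using Hom_inverse[OF P Q \<phi>(1)] \<phi>(2) by simp
  moreover have "compose P ?\<psi> \<phi> = restrict id P"
    using \<phi>(2) inj by (auto simp: compose_def fun_eq_iff)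
  moreover have "compose Q \<phi> ?\<psi> = restrict id Q"
    using \<phi>(2) by (auto simp: compose_def fun_eq_iff f_inv_into_f)
  ultimately show "F_conj Hom P Q" using \<phi>(1) unfolding F_conj_def by blast
qed

lemma F_conj_image:
  assumes "subgroup P G" "subgroup Q G" "\<phi> \<in> Hom P Q"
  shows "F_conj Hom P (\<phi> ` P)"
  using F_conj_iff[OF assms(1) subgroup_image[OF assms]] Hom_image[OF assms] by blast

lemma F_conj_trans:
  assumes sub: "subgroup P G" "subgroup Q G" "subgroup R G" and "F_conj Hom P Q" "F_conj Hom Q R"
  shows "F_conj Hom P R"
proof -
  obtain \<phi> \<psi> where "\<phi> \<in> Hom P Q" "\<phi> ` P = Q" "\<psi> \<in> Hom Q R" "\<psi> ` Q = R"
    using assms(4,5) by (auto simp: F_conj_iff sub)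
  then have "compose P \<psi> \<phi> \<in> Hom P R" "compose P \<psi> \<phi> ` P = R"
    using Hom_compose sub by (auto simp: compose_def image_iff)
  then show ?thesis using F_conj_iff sub by blast
qed

lemma F_conj_card:
  assumes "subgroup P G" "subgroup Q G" "F_conj Hom P Q"
  shows "card Q = card P"
proof -
  obtain \<phi> where "\<phi> \<in> Hom P Q" "\<phi> ` P = Q" using assms F_conj_iff by blast
  then show ?thesis using HomD(3)[OF assms(1,2)] card_image by metis
qed

lemma F_conj_refl: "subgroup P G \<Longrightarrow> F_conj Hom P P"
  using inclusion_Hom[of P P] by (subst F_conj_iff) (auto intro!: bexI[of _ "restrict id P"])

lemma exists_fully_normalized:
  assumes P: "subgroup P G"
  obtains Q where "subgroup Q G" "F_conj Hom P Q" "fully_normalized G Hom Q"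
proof -
  let ?X = "{Q. subgroup Q G \<and> F_conj Hom P Q}"
  have "?X \<subseteq> Pow (carrier G)" using subgroup.subset by blast
  then have "finite ?X" using fin finite_subset by blast
  moreover have "?X \<noteq> {}" using P F_conj_refl by blast
  ultimately obtain Q where Q: "Q \<in> ?X" "Max ((\<lambda>R. card (normalizerS G R)) ` ?X) = card (normalizerS G Q)"
    by (rule obtains_MAX)
  have "card (normalizerS G R) \<le> card (normalizerS G Q)" if "R \<in> ?X" for R
    unfolding Q(2)[symmetric] using \<open>finite ?X\<close> that by (intro Max_ge) auto
  with Q(1) have "fully_normalized G Hom Q"
    unfolding fully_normalized_def using F_conj_trans[OF P] by blast
  then show ?thesis using that Q by blast
qed

text \<open>On a finite P injective endomorphisms are bijective, so \<open>Hom P P\<close> is all of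
  Aut_F(P). As a group record it becomes accessible to the Sylow and order arguments above;
  \<open>restrict id P\<close> is the unit because morphisms are extensional.\<close>

definition Aut :: "'a set \<Rightarrow> ('a \<Rightarrow> 'a) monoid" where
  "Aut P = \<lparr>carrier = Hom P P, monoid.mult = compose P, one = restrict id P\<rparr>"

lemma Aut_simps [simp]:
  "carrier (Aut P) = Hom P P" "monoid.mult (Aut P) = compose P" "one (Aut P) = restrict id P"
  by (simp_all add: Aut_def)

lemma group_Aut:
  assumes P: "subgroup P G"
  shows "group (Aut P)"
proof (rule groupI; simp)
  fix \<phi> assume \<phi>: "\<phi> \<in> Hom P P"
  note D = HomD[OF P P \<phi>]
  show "compose P (restrict id P) \<phi> = \<phi>"
    using D by (intro extensionalityI[of _ P]) (auto simp: compose_def)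
  have "\<phi> ` P = P"
    using D endo_inj_surj[OF finite_subgroup[OF P]] by blast
  then have "restrict (inv_into P \<phi>) P \<in> Hom P P" "compose P (restrict (inv_into P \<phi>) P) \<phi> = restrict id P"
    using Hom_inverse[OF P P \<phi>] D by (auto simp: compose_def fun_eq_iff)
  then show "\<exists>\<psi>\<in>Hom P P. compose P \<psi> \<phi> = restrict id P" by blast
next
  fix \<phi> \<psi> \<chi> assume "\<phi> \<in> Hom P P" "\<psi> \<in> Hom P P" "\<chi> \<in> Hom P P"
  then show "compose P (compose P \<phi> \<psi>) \<chi> = compose P \<phi> (compose P \<psi> \<chi>)"
    using HomD(2)[OF P P] by (auto simp: compose_def fun_eq_iff Pi_iff)
qed (use P Hom_compose inclusion_Hom in auto)

lemma finite_Hom: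
  assumes "subgroup P G" "subgroup Q G"
  shows "finite (Hom P Q)"
proof -
  have "Hom P Q \<subseteq> P \<rightarrow>\<^sub>E Q"
    using HomD[OF assms] by (auto simp: PiE_def)
  then show ?thesis
    using finite_PiE[of P "\<lambda>_. Q"] finite_subgroup assms finite_subset by blast
qed

lemma Aut_inv:
  assumes P: "subgroup P G" and \<phi>: "\<phi> \<in> Hom P P"
  shows "inv\<^bsub>Aut P\<^esub> \<phi> \<in> Hom P P"
    and "x \<in> P \<Longrightarrow> (inv\<^bsub>Aut P\<^esub> \<phi>) (\<phi> x) = x" and "x \<in> P \<Longrightarrow> \<phi> ((inv\<^bsub>Aut P\<^esub> \<phi>) x) = x"
proof -
  interpret AutP: group "Aut P" by (rule group_Aut[OF P])
  show "inv\<^bsub>Aut P\<^esub> \<phi> \<in> Hom P P" using AutP.inv_closed \<phi> by simp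
  show "(inv\<^bsub>Aut P\<^esub> \<phi>) (\<phi> x) = x" if "x \<in> P"
    using fun_cong[OF AutP.l_inv, of \<phi> x] \<phi> that by (simp add: compose_def)
  show "\<phi> ((inv\<^bsub>Aut P\<^esub> \<phi>) x) = x" if "x \<in> P"
    using fun_cong[OF AutP.r_inv, of \<phi> x] \<phi> that by (simp add: compose_def)
qed

lemma Aut_pow:
  fixes n :: nat
  assumes P: "subgroup P G" and \<phi>: "\<phi> \<in> Hom P P" and x: "x \<in> P"
  shows "(\<phi> [^]\<^bsub>Aut P\<^esub> n) x = (\<phi> ^^ n) x"
  using x
proof (induction n arbitrary: x)
  case (Suc n)
  then show ?case
    using HomD(2)[OF P P \<phi>] by (simp add: compose_def funpow_swap1 Pi_iff)
qed simp

text \<open>The bridge between orders in \<open>Aut P\<close> and the pointwise statements about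
  iterates of endomorphisms.\<close>

lemma Aut_pow_eq_one_iff:
  fixes n :: nat
  assumes P: "subgroup P G" and \<phi>: "\<phi> \<in> Hom P P"
  shows "\<phi> [^]\<^bsub>Aut P\<^esub> n = \<one>\<^bsub>Aut P\<^esub> \<longleftrightarrow> (\<forall>x\<in>P. (\<phi> ^^ n) x = x)"
proof -
  interpret AutP: group "Aut P" by (rule group_Aut[OF P])
  have "\<phi> [^]\<^bsub>Aut P\<^esub> n \<in> Hom P P" using AutP.nat_pow_closed[of \<phi> n] \<phi> by simp
  then have "\<phi> [^]\<^bsub>Aut P\<^esub> n \<in> extensional P" by (rule HomD[OF P P])
  then show ?thesis
    using Aut_pow[OF P \<phi>] by (auto simp: extensional_def fun_eq_iff)
qed

lemma subgroup_HomS: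
  assumes P: "subgroup P G"
  shows "subgroup (HomS G P P) (Aut P)"
proof -
  interpret P: subgroup P G by (rule P)
  interpret AutP: group "Aut P" by (rule group_Aut[OF P])
  note sub = HomS_subset[OF P P]
  note D = HomD[OF P P]
  have one: "restrict id P \<in> HomS G P P"
    by (rule HomS_I[OF P P, where g = \<one>]) auto
  show ?thesis
  proof (rule AutP.subgroupI)
    show "HomS G P P \<subseteq> carrier (Aut P)" using sub by simp
    show "HomS G P P \<noteq> {}" using one by blast
  next
    fix \<phi> assume \<phi>: "\<phi> \<in> HomS G P P"
    then have \<phi>H: "\<phi> \<in> Hom P P" using sub by blast
    obtain g where g: "g \<in> carrier G" "\<And>x. x \<in> P \<Longrightarrow> \<phi> x = g \<otimes> x \<otimes> inv g"
      using HomS_D[OF \<phi>] by blast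
    note I = Aut_inv[OF P \<phi>H]
    have IP: "(inv\<^bsub>Aut P\<^esub> \<phi>) x \<in> P" if "x \<in> P" for x using D(2)[OF I(1)] that by blast
    show "inv\<^bsub>Aut P\<^esub> \<phi> \<in> HomS G P P"
    proof (rule HomS_I[OF P P D(1,2)[OF I(1)], where g = "inv g"])
      fix x assume x: "x \<in> P"
      define y where "y = (inv\<^bsub>Aut P\<^esub> \<phi>) x"
      have "y \<in> P" "x = g \<otimes> y \<otimes> inv g" using I(3)[OF x] g(2) IP[OF x] by (auto simp: y_def)
      then have "y = inv g \<otimes> x \<otimes> inv (inv g)"
        using g(1) by (simp add: word_simps)
      then show "(inv\<^bsub>Aut P\<^esub> \<phi>) x = inv g \<otimes> x \<otimes> inv (inv g)" by (simp add: y_def)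
    qed (use g in simp)
  next
    fix \<phi> \<psi> assume \<phi>: "\<phi> \<in> HomS G P P" and \<psi>: "\<psi> \<in> HomS G P P"
    then have H: "\<phi> \<in> Hom P P" "\<psi> \<in> Hom P P" using sub by blast+
    obtain g where g: "g \<in> carrier G" "\<And>x. x \<in> P \<Longrightarrow> \<phi> x = g \<otimes> x \<otimes> inv g"
      using HomS_D[OF \<phi>] by blast
    obtain h where h: "h \<in> carrier G" "\<And>x. x \<in> P \<Longrightarrow> \<psi> x = h \<otimes> x \<otimes> inv h"
      using HomS_D[OF \<psi>] by blast
    have "compose P \<phi> \<psi> \<in> HomS G P P"
    proof (rule HomS_I[OF P P, where g = "g \<otimes> h"])
      show "compose P \<phi> \<psi> \<in> P \<rightarrow> P" using D(2) H by (auto simp: compose_def Pi_iff)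
      fix x assume x: "x \<in> P"
      have "compose P \<phi> \<psi> x = \<phi> (\<psi> x)" using x by (simp add: compose_def)
      also have "\<dots> = g \<otimes> (\<psi> x) \<otimes> inv g" by (rule g(2)) (use D(2)[OF H(2)] x in blast)
      also have "\<dots> = g \<otimes> h \<otimes> x \<otimes> inv (g \<otimes> h)" using x g(1) h by (simp add: word_simps)
      finally show "compose P \<phi> \<psi> x = g \<otimes> h \<otimes> x \<otimes> inv (g \<otimes> h)" .
    qed (use g h in auto)
    then show "\<phi> \<otimes>\<^bsub>Aut P\<^esub> \<psi> \<in> HomS G P P" by simp
  qed
qed

section \<open>The extension domain in condition (II)\<close>

text \<open>Substituting y = \<phi> x removes the inverse of \<phi> from the defining condition and
  leaves an intertwining relation between g and some h.\<close>

lemma N_phi_iff: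
  assumes P: "subgroup P G" and \<phi>: "\<phi> \<in> Hom P (carrier G)"
  shows "g \<in> N_phi G P \<phi> \<longleftrightarrow> g \<in> normalizerS G P \<and>
    (\<exists>h\<in>carrier G. \<forall>x\<in>P. \<phi> (g \<otimes> x \<otimes> inv g) = h \<otimes> \<phi> x \<otimes> inv h)"
proof -
  note D = HomD[OF P subgroup_self \<phi>]
  let ?f = "restrict (\<lambda>y. \<phi> (g \<otimes> inv_into P \<phi> y \<otimes> inv g)) (\<phi> ` P)"
  note im = subgroup_image[OF P subgroup_self \<phi>]
  have f: "?f (\<phi> x) = \<phi> (g \<otimes> x \<otimes> inv g)" if "x \<in> P" for x
    using that D(3) by simp
  show ?thesis
  proof
    assume "g \<in> N_phi G P \<phi>"
    then have gN: "g \<in> normalizerS G P" and fH: "?f \<in> HomS G (\<phi> ` P) (\<phi> ` P)"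
      by (auto simp: N_phi_def)
    obtain h where "h \<in> carrier G" "\<forall>y\<in>\<phi> ` P. ?f y = h \<otimes> y \<otimes> inv h"
      using HomS_D[OF fH] by blast
    then show "g \<in> normalizerS G P \<and> (\<exists>h\<in>carrier G. \<forall>x\<in>P. \<phi> (g \<otimes> x \<otimes> inv g) = h \<otimes> \<phi> x \<otimes> inv h)"
      using gN f by (metis imageI)
  next
    assume R: "g \<in> normalizerS G P \<and> (\<exists>h\<in>carrier G. \<forall>x\<in>P. \<phi> (g \<otimes> x \<otimes> inv g) = h \<otimes> \<phi> x \<otimes> inv h)"
    then obtain h where h: "h \<in> carrier G" "\<And>x. x \<in> P \<Longrightarrow> \<phi> (g \<otimes> x \<otimes> inv g) = h \<otimes> \<phi> x \<otimes> inv h"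
      by blast
    have "?f \<in> HomS G (\<phi> ` P) (\<phi> ` P)"
    proof (rule HomS_I[OF im im _ _ h(1)])
      show "?f \<in> \<phi> ` P \<rightarrow> \<phi> ` P"
        using f normalizerS_D(2)[of g P] R by auto
      fix y assume "y \<in> \<phi> ` P"
      then show "?f y = h \<otimes> y \<otimes> inv h" using f h(2) by auto
    qed simp
    then show "g \<in> N_phi G P \<phi>" using R by (simp add: N_phi_def)
  qed
qed

lemma subgroup_normalizerS:
  assumes P: "subgroup P G"
  shows "subgroup (normalizerS G P) G"
proof -
  interpret P: subgroup P G by (rule P)
  note I = normalizerS_I[OF fin _ P.subset] and D = normalizerS_D
  show ?thesis
  proof (rule subgroupI)
    show "normalizerS G P \<subseteq> carrier G" by (auto simp: normalizerS_def)
    have "\<one> \<in> normalizerS G P" by (rule I) auto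
    then show "normalizerS G P \<noteq> {}" by blast
  next
    fix g assume g: "g \<in> normalizerS G P"
    show "inv g \<in> normalizerS G P"
    proof (rule I)
      show gc: "inv g \<in> carrier G" using D(1)[OF g] by simp
      fix x assume x: "x \<in> P"
      then have "x \<in> conjset G g P" using g by (simp add: normalizerS_def)
      then obtain y where y: "y \<in> P" "x = g \<otimes> y \<otimes> inv g" by (auto simp: conjset_def)
      then have "inv g \<otimes> x \<otimes> inv (inv g) = y" using D(1)[OF g] by (simp add: word_simps)
      then show "inv g \<otimes> x \<otimes> inv (inv g) \<in> P" using y by simp
    qed
  next
    fix g h assume g: "g \<in> normalizerS G P" and h: "h \<in> normalizerS G P"
    note gc = D(1)[OF g] and hc = D(1)[OF h]
    show "g \<otimes> h \<in> normalizerS G P"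
    proof (rule I)
      fix x assume x: "x \<in> P"
      have "g \<otimes> (h \<otimes> x \<otimes> inv h) \<otimes> inv g \<in> P" by (intro D(2) g h x)
      then show "g \<otimes> h \<otimes> x \<otimes> inv (g \<otimes> h) \<in> P" using gc hc x by (simp add: word_simps)
    qed (use gc hc in simp)
  qed
qed

lemma subgroup_N_phi:
  assumes P: "subgroup P G" and \<phi>: "\<phi> \<in> Hom P (carrier G)"
  shows "subgroup (N_phi G P \<phi>) G"
proof -
  interpret P: subgroup P G by (rule P)
  interpret N: subgroup "normalizerS G P" G by (rule subgroup_normalizerS[OF P])
  note iff = N_phi_iff[OF P \<phi>]
  note D = HomD[OF P subgroup_self \<phi>]
  have \<phi>c: "\<phi> x \<in> carrier G" if "x \<in> P" for x using D(2) that by blast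
  show ?thesis
  proof (rule subgroupI)
    show "N_phi G P \<phi> \<subseteq> carrier G" using iff by auto
    have "\<one> \<in> N_phi G P \<phi>" unfolding iff using \<phi>c by (auto intro!: bexI[of _ \<one>])
    then show "N_phi G P \<phi> \<noteq> {}" by blast
  next
    fix g assume g: "g \<in> N_phi G P \<phi>"
    then have gN: "g \<in> normalizerS G P" using iff by blast
    then have gc: "g \<in> carrier G" by simp
    obtain h where h: "h \<in> carrier G" "\<And>x. x \<in> P \<Longrightarrow> \<phi> (g \<otimes> x \<otimes> inv g) = h \<otimes> \<phi> x \<otimes> inv h"
      using g iff by blast
    have igN: "inv g \<in> normalizerS G P" using gN by simp
    have "\<phi> (inv g \<otimes> x \<otimes> inv (inv g)) = inv h \<otimes> \<phi> x \<otimes> inv (inv h)" if x: "x \<in> P" for x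
    proof -
      define y where "y = inv g \<otimes> x \<otimes> inv (inv g)"
      have y: "y \<in> P" unfolding y_def by (rule normalizerS_D(2)[OF igN x])
      have "g \<otimes> y \<otimes> inv g = x" using gc x by (simp add: y_def word_simps)
      then have "\<phi> x = h \<otimes> \<phi> y \<otimes> inv h" using h(2)[OF y] by simp
      then have "\<phi> y = inv h \<otimes> \<phi> x \<otimes> inv (inv h)" using h(1) \<phi>c[OF y] by (simp add: word_simps)
      then show ?thesis by (simp add: y_def)
    qed
    then show "inv g \<in> N_phi G P \<phi>" unfolding iff using igN h(1) by blast
  next
    fix g g' assume g: "g \<in> N_phi G P \<phi>" and g': "g' \<in> N_phi G P \<phi>"
    then have gN: "g \<in> normalizerS G P" "g' \<in> normalizerS G P" using iff by blast+
    then have gc: "g \<in> carrier G" "g' \<in> carrier G" by simp_all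
    obtain h where h: "h \<in> carrier G" "\<And>x. x \<in> P \<Longrightarrow> \<phi> (g \<otimes> x \<otimes> inv g) = h \<otimes> \<phi> x \<otimes> inv h"
      using g iff by blast
    obtain h' where h': "h' \<in> carrier G" "\<And>x. x \<in> P \<Longrightarrow> \<phi> (g' \<otimes> x \<otimes> inv g') = h' \<otimes> \<phi> x \<otimes> inv h'"
      using g' iff by blast
    have "\<phi> ((g \<otimes> g') \<otimes> x \<otimes> inv (g \<otimes> g')) = (h \<otimes> h') \<otimes> \<phi> x \<otimes> inv (h \<otimes> h')" if x: "x \<in> P" for x
    proof -
      have "(g \<otimes> g') \<otimes> x \<otimes> inv (g \<otimes> g') = g \<otimes> (g' \<otimes> x \<otimes> inv g') \<otimes> inv g"
        using gc x by (simp add: word_simps)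
      then have "\<phi> ((g \<otimes> g') \<otimes> x \<otimes> inv (g \<otimes> g')) = h \<otimes> (h' \<otimes> \<phi> x \<otimes> inv h') \<otimes> inv h"
        using h(2)[OF normalizerS_D(2)[OF gN(2) x]] h'(2)[OF x] by simp
      then show ?thesis using h(1) h'(1) \<phi>c[OF x] by (simp add: word_simps)
    qed
    then show "g \<otimes> g' \<in> N_phi G P \<phi>" unfolding iff using gN h(1) h'(1) by blast
  qed
qed

text \<open>For g in P, \<phi> carries conjugation by g to conjugation by \<phi> g.\<close>

lemma subset_N_phi:
  assumes P: "subgroup P G" and \<phi>: "\<phi> \<in> Hom P (carrier G)"
  shows "P \<subseteq> N_phi G P \<phi>"
proof
  interpret P: subgroup P G by (rule P)
  note D = HomD[OF P subgroup_self \<phi>]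
  fix g assume g: "g \<in> P"
  have "\<phi> (g \<otimes> x \<otimes> inv g) = \<phi> g \<otimes> \<phi> x \<otimes> inv (\<phi> g)" if x: "x \<in> P" for x
  proof -
    have "\<phi> (g \<otimes> x \<otimes> inv g) \<otimes> \<phi> g = \<phi> (g \<otimes> x \<otimes> inv g \<otimes> g)"
      using g x by (intro D(4)[symmetric]) auto
    also have "g \<otimes> x \<otimes> inv g \<otimes> g = g \<otimes> x" using g x by (simp add: word_simps)
    also have "\<phi> (g \<otimes> x) = \<phi> g \<otimes> \<phi> x" by (rule D(4)[OF g x])
    finally have "\<phi> (g \<otimes> x \<otimes> inv g) \<otimes> \<phi> g = \<phi> g \<otimes> \<phi> x" .
    moreover have "\<phi> g \<in> carrier G" "\<phi> x \<in> carrier G" "\<phi> (g \<otimes> x \<otimes> inv g) \<in> carrier G"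
      using D(2) g x by (auto simp: Pi_iff)
    ultimately show ?thesis by (simp add: inv_solve_right)
  qed
  moreover have "\<phi> g \<in> carrier G" using D(2) g by blast
  moreover have "g \<in> normalizerS G P"
    using g by (intro normalizerS_I[OF fin _ P.subset]) auto
  ultimately show "g \<in> N_phi G P \<phi>" unfolding N_phi_iff[OF P \<phi>] by blast
qed

end

section \<open>Weakly closed elementary abelian subgroups\<close>

lemma (in group) elementary_abelian_subset:
  assumes "elementary_abelian p G V" "subgroup W G" "W \<subseteq> V"
  shows "elementary_abelian p G W"
  using assms unfolding elementary_abelian_def by blast

locale weakly_closed_fusion_system = p_fusion_system +
  assumes odd_p: "odd p" and sat: "saturated p G Hom"
    and wc: "\<And>V. V \<lhd> G \<Longrightarrow> elementary_abelian p G V \<Longrightarrow> weakly_closed G Hom V"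
    and p_aut: "\<And>V. V \<lhd> G \<Longrightarrow> elementary_abelian p G V \<Longrightarrow> \<exists>k. card (Hom V V) = p ^ k"
begin

lemma image_weakly_closed:
  assumes V: "V \<lhd> G" "elementary_abelian p G V"
    and PQ: "subgroup P G" "subgroup Q G" "V \<subseteq> P" and \<phi>: "\<phi> \<in> Hom P Q"
  shows "\<phi> ` V = V"
proof -
  have sub: "subgroup V G" using V(1) by (rule normal_imp_subgroup)
  have r: "restrict \<phi> V \<in> Hom V Q" by (rule Hom_restrict[OF sub PQ \<phi>])
  have "restrict \<phi> V ` V = V"
    using wc[OF V] subgroup_image[OF sub PQ(2) r] F_conj_image[OF sub PQ(2) r]
    unfolding weakly_closed_def by blast
  then show ?thesis by simp
qed

lemma exists_max_normal_elementary_abelian: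
  obtains A where "max_normal_elementary_abelian G p A"
proof -
  let ?X = "{A. A \<lhd> G \<and> elementary_abelian p G A}"
  have "?X \<subseteq> Pow (carrier G)" using normal_imp_subgroup subgroup.subset by blast
  then have fX: "finite ?X" using fin finite_subset by blast
  have "elementary_abelian p G {\<one>}" using triv_subgroup by (simp add: elementary_abelian_def)
  then have "?X \<noteq> {}" using one_is_normal by blast
  with fX obtain A where A: "A \<in> ?X" "Max (card ` ?X) = card A"
    by (rule obtains_MAX)
  have max: "card B \<le> card A" if "B \<in> ?X" for B
    unfolding A(2)[symmetric] using fX that by (intro Max_ge) auto
  have "max_normal_elementary_abelian G p A"
  proof (intro max_normal_elementary_abelian.intro max_normal_elementary_abelian_axioms.intro is_group)
    show "Factorial_Ring.prime p" "odd p" "finite (carrier G)" by (rule prime_p odd_p fin)+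
    show "\<exists>k. card (carrier G) = p ^ k" using p_grp by (simp add: p_group_def)
    show "A \<lhd> G" "elementary_abelian p G A" using A by auto
    fix B assume B: "B \<lhd> G" "elementary_abelian p G B" "A \<subseteq> B"
    then have "finite B" using finite_subgroup normal_imp_subgroup by blast
    then show "B = A" using card_seteq B max[of B] by blast
  qed
  then show ?thesis using that by blast
qed

text \<open>The restriction of \<alpha> to A has order dividing \<open>p ^ k\<close>, so that
  iterate of \<alpha> fixes A pointwise and falls under \<open>endo_fixing_A_prime_power\<close>.
  The exponents add to k + m + m.\<close>

lemma Aut_prime_power_order:
  assumes A: "max_normal_elementary_abelian G p A" and Q: "subgroup Q G" "A \<subseteq> Q"
    and \<alpha>: "\<alpha> \<in> Hom Q Q"
  shows "\<exists>n. \<alpha> [^]\<^bsub>Aut Q\<^esub> (p ^ n) = \<one>\<^bsub>Aut Q\<^esub>"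
proof -
  interpret max_normal_elementary_abelian G p A by (rule A)
  note subA = A.subgroup_axioms
  note D = HomD[OF Q(1) Q(1) \<alpha>]
  obtain m where m: "card (carrier G) = p ^ m" using ord_power by blast
  obtain k where k: "card (Hom A A) = p ^ k" using p_aut[OF normal_A elementary_A] by blast
  define \<beta> where "\<beta> = restrict \<alpha> A"
  have \<alpha>A: "\<alpha> ` A = A" by (rule image_weakly_closed[OF normal_A elementary_A Q(1) Q \<alpha>])
  have "\<beta> \<in> Hom A Q" unfolding \<beta>_def by (rule Hom_restrict[OF subA Q(1) Q \<alpha>])
  then have \<beta>: "\<beta> \<in> Hom A A"
    using Hom_image[OF subA Q(1), of \<beta>] \<alpha>A by (simp add: \<beta>_def)
  interpret AutA: group "Aut A" by (rule group_Aut[OF subA])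
  have "\<beta> [^]\<^bsub>Aut A\<^esub> (p ^ k) = \<one>\<^bsub>Aut A\<^esub>"
    using AutA.pow_order_eq_1[of \<beta>] \<beta> k by (simp add: order_def)
  then have \<beta>k: "(\<beta> ^^ (p ^ k)) a = a" if "a \<in> A" for a
    using Aut_pow_eq_one_iff[OF subA \<beta>] that by blast
  have eq: "(\<beta> ^^ n) a = (\<alpha> ^^ n) a \<and> (\<alpha> ^^ n) a \<in> A" if "a \<in> A" for a n
    by (induction n) (use that \<alpha>A in \<open>auto simp: \<beta>_def\<close>)
  define f where "f = \<alpha> ^^ (p ^ k)"
  have f: "f \<in> Q \<rightarrow> Q" "\<And>x y. x \<in> Q \<Longrightarrow> y \<in> Q \<Longrightarrow> f (x \<otimes> y) = f x \<otimes> f y"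
    unfolding f_def using endo_funpow[OF D(2,4)] by blast+
  have "(f ^^ (p ^ m * p ^ m)) x = x" if "x \<in> Q" for x
  proof (rule endo_fixing_A_prime_power[OF Q m f _ that])
    show "f a = a" if "a \<in> A" for a
      unfolding f_def using \<beta>k[OF that] eq[OF that, of "p ^ k"] by simp
  qed
  then have "\<forall>x\<in>Q. (\<alpha> ^^ (p ^ (k + (m + m)))) x = x"
    by (simp add: f_def funpow_mult power_add)
  then show ?thesis using Aut_pow_eq_one_iff[OF Q(1) \<alpha>] by blast
qed

lemma sylow_HomS:
  assumes "subgroup Q G" "fully_normalized G Hom Q"
  shows "sylow_card p (card (HomS G Q Q)) (card (Hom Q Q))"
  using sat assms unfolding saturated_def by blast

lemma extends_to_N_phi:
  assumes "subgroup P G" "\<phi> \<in> Hom P (carrier G)" "subgroup Q G" "\<phi> ` P = Q" "fully_normalized G Hom Q"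
  obtains \<psi> where "\<psi> \<in> Hom (N_phi G P \<phi>) (carrier G)" "\<And>x. x \<in> P \<Longrightarrow> \<psi> x = \<phi> x"
proof -
  have "fully_centralized G Hom Q"
    using sat assms unfolding saturated_def by blast
  then show ?thesis
    using sat assms that unfolding saturated_def by blast
qed

text \<open>Here \<open>larger\<close> is the downward induction hypothesis. One element of N_phi
  outside P makes the domain of the extension strictly larger than P, so the extension, and with it
  \<phi>, is conjugation by an element of S.\<close>

lemma extends_imp_conj:
  assumes P: "subgroup P G" and \<phi>: "\<phi> \<in> Hom P (carrier G)"
    and Q: "subgroup Q G" "\<phi> ` P = Q" "fully_normalized G Hom Q"
    and proper: "g \<in> N_phi G P \<phi>" "g \<notin> P"
    and larger: "\<And>R. subgroup R G \<Longrightarrow> card P < card R \<Longrightarrow> Hom R (carrier G) \<subseteq> HomS G R (carrier G)"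
  shows "\<exists>h\<in>carrier G. \<forall>x\<in>P. \<phi> x = h \<otimes> x \<otimes> inv h"
proof -
  let ?N = "N_phi G P \<phi>"
  obtain \<psi> where \<psi>: "\<psi> \<in> Hom ?N (carrier G)" "\<And>x. x \<in> P \<Longrightarrow> \<psi> x = \<phi> x"
    using extends_to_N_phi[OF P \<phi> Q] by blast
  have N: "subgroup ?N G" by (rule subgroup_N_phi[OF P \<phi>])
  have sub: "P \<subseteq> ?N" by (rule subset_N_phi[OF P \<phi>])
  then have "card P < card ?N"
    using proper finite_subgroup[OF N] psubset_card_mono by blast
  then have "\<psi> \<in> HomS G ?N (carrier G)" using larger[OF N] \<psi>(1) by blast
  then obtain h where "h \<in> carrier G" "\<forall>x\<in>?N. \<psi> x = h \<otimes> x \<otimes> inv h"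
    using HomS_D by blast
  then show ?thesis using \<psi>(2) sub by (metis subsetD)
qed

text \<open>The automorphisms centralizing both V and the quotient by V form a normal p-subgroup of the
  automorphism group, so they lie in every Sylow p-subgroup.\<close>

lemma stability_subset_HomS:
  assumes Q: "subgroup Q G" "fully_normalized G Hom Q"
    and V: "V \<lhd> G" "elementary_abelian p G V" "V \<subseteq> Q"
  defines "D \<equiv> {\<alpha> \<in> Hom Q Q. (\<forall>v\<in>V. \<alpha> v = v) \<and> (\<forall>x\<in>Q. \<exists>v\<in>V. \<alpha> x = x \<otimes> v)}"
  shows "D \<lhd> Aut Q" and "D \<subseteq> HomS G Q Q"
proof -
  interpret AutQ: group "Aut Q" by (rule group_Aut[OF Q(1)])
  interpret Q: subgroup Q G by (rule Q(1))
  interpret V: normal V G by (rule V(1))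
  note H = HomD[OF Q(1) Q(1)] and I = Aut_inv[OF Q(1)]
  have V_pow: "v [^] p = \<one>" if "v \<in> V" for v using V(2) that by (simp add: elementary_abelian_def)
  have VQ: "v \<in> Q" if "v \<in> V" for v using that V(3) by blast
  have vc: "v \<in> carrier G" if "v \<in> V" for v using that by simp
  have D_H: "\<alpha> \<in> Hom Q Q" and D_V: "\<And>v. v \<in> V \<Longrightarrow> \<alpha> v = v"
    and D_Q: "\<And>x. x \<in> Q \<Longrightarrow> \<exists>v\<in>V. \<alpha> x = x \<otimes> v" if "\<alpha> \<in> D" for \<alpha>
    using that by (simp_all add: D_def)
  have DI: "\<alpha> \<in> D" if "\<alpha> \<in> Hom Q Q" "\<And>v. v \<in> V \<Longrightarrow> \<alpha> v = v" "\<And>x. x \<in> Q \<Longrightarrow> \<exists>v\<in>V. \<alpha> x = x \<otimes> v" for \<alpha>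
    using that by (simp add: D_def)
  have inv_D: "inv\<^bsub>Aut Q\<^esub> \<alpha> \<in> D" if \<alpha>: "\<alpha> \<in> D" for \<alpha>
  proof (rule DI)
    note \<alpha>H = D_H[OF \<alpha>]
    define \<beta> where "\<beta> = inv\<^bsub>Aut Q\<^esub> \<alpha>"
    have \<beta>: "\<beta> \<in> Hom Q Q" "\<And>x. x \<in> Q \<Longrightarrow> \<beta> (\<alpha> x) = x" "\<And>x. x \<in> Q \<Longrightarrow> \<alpha> (\<beta> x) = x"
      using I[OF \<alpha>H] by (simp_all add: \<beta>_def)
    show "inv\<^bsub>Aut Q\<^esub> \<alpha> \<in> Hom Q Q" by (rule I(1)[OF \<alpha>H])
    show "(inv\<^bsub>Aut Q\<^esub> \<alpha>) v = v" if "v \<in> V" for v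
      using \<beta>(2)[OF VQ[OF that]] D_V[OF \<alpha> that] by (simp add: \<beta>_def)
    show "\<exists>v\<in>V. (inv\<^bsub>Aut Q\<^esub> \<alpha>) x = x \<otimes> v" if x: "x \<in> Q" for x
    proof -
      have \<beta>x: "\<beta> x \<in> Q" using H(2)[OF \<beta>(1)] x by blast
      then obtain v where v: "v \<in> V" "\<alpha> (\<beta> x) = \<beta> x \<otimes> v" using D_Q[OF \<alpha>] by blast
      then have "\<beta> x = x \<otimes> inv v"
        using \<beta>(3)[OF x] x \<beta>x vc[OF v(1)] by (metis Q.mem_carrier inv_solve_right)
      then show ?thesis using v(1) unfolding \<beta>_def by blast
    qed
  qed
  have mult_D: "compose Q \<alpha> \<beta> \<in> D" if \<alpha>: "\<alpha> \<in> D" and \<beta>: "\<beta> \<in> D" for \<alpha> \<beta>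
  proof (rule DI)
    show "compose Q \<alpha> \<beta> \<in> Hom Q Q" using Hom_compose Q(1) D_H \<alpha> \<beta> by blast
    show "compose Q \<alpha> \<beta> v = v" if "v \<in> V" for v
      using that VQ D_V[OF \<alpha>] D_V[OF \<beta>] by (simp add: compose_def)
    show "\<exists>v\<in>V. compose Q \<alpha> \<beta> x = x \<otimes> v" if x: "x \<in> Q" for x
    proof -
      obtain v where v: "v \<in> V" "\<beta> x = x \<otimes> v" using D_Q[OF \<beta> x] by blast
      obtain w where w: "w \<in> V" "\<alpha> x = x \<otimes> w" using D_Q[OF \<alpha> x] by blast
      have "\<alpha> (x \<otimes> v) = x \<otimes> (w \<otimes> v)"
        using H(4)[OF D_H[OF \<alpha>] x VQ[OF v(1)]] D_V[OF \<alpha> v(1)] w x v(1) by (simp add: m_assoc)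
      then have "compose Q \<alpha> \<beta> x = x \<otimes> (w \<otimes> v)" using x v(2) by (simp add: compose_def)
      then show ?thesis using v(1) w(1) by blast
    qed
  qed
  have conj_D: "compose Q (compose Q \<gamma> \<alpha>) (inv\<^bsub>Aut Q\<^esub> \<gamma>) \<in> D" if \<gamma>: "\<gamma> \<in> Hom Q Q" and \<alpha>: "\<alpha> \<in> D" for \<gamma> \<alpha>
  proof (rule DI)
    define \<beta> where "\<beta> = inv\<^bsub>Aut Q\<^esub> \<gamma>"
    have \<beta>: "\<beta> \<in> Hom Q Q" "\<And>x. x \<in> Q \<Longrightarrow> \<beta> (\<gamma> x) = x" "\<And>x. x \<in> Q \<Longrightarrow> \<gamma> (\<beta> x) = x"
      using I[OF \<gamma>] by (simp_all add: \<beta>_def)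
    have \<beta>Q: "\<beta> x \<in> Q" if "x \<in> Q" for x using H(2)[OF \<beta>(1)] that by blast
    \<comment> \<open>Weak closure enters here: \<gamma> and its inverse both preserve V. Hence the
      conjugate is still the identity on V, and a displacement v of \<alpha> turns into \<gamma> v,
      again in V.\<close>
    have im: "\<delta> v \<in> V" if "\<delta> \<in> Hom Q Q" "v \<in> V" for \<delta> v
      using image_weakly_closed[OF V(1,2) Q(1) Q(1) V(3) that(1)] that(2) by blast
    have val: "compose Q (compose Q \<gamma> \<alpha>) \<beta> x = \<gamma> (\<alpha> (\<beta> x))" if "x \<in> Q" for x
      using that \<beta>Q by (simp add: compose_def)
    show "compose Q (compose Q \<gamma> \<alpha>) (inv\<^bsub>Aut Q\<^esub> \<gamma>) \<in> Hom Q Q"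
      using Hom_compose Q(1) D_H[OF \<alpha>] \<gamma> \<beta>(1) unfolding \<beta>_def by blast
    show "compose Q (compose Q \<gamma> \<alpha>) (inv\<^bsub>Aut Q\<^esub> \<gamma>) v = v" if v: "v \<in> V" for v
      using val[OF VQ[OF v]] D_V[OF \<alpha> im[OF \<beta>(1) v]] \<beta>(3)[OF VQ[OF v]] by (simp add: \<beta>_def)
    show "\<exists>v\<in>V. compose Q (compose Q \<gamma> \<alpha>) (inv\<^bsub>Aut Q\<^esub> \<gamma>) x = x \<otimes> v" if x: "x \<in> Q" for x
    proof -
      obtain v where v: "v \<in> V" "\<alpha> (\<beta> x) = \<beta> x \<otimes> v" using D_Q[OF \<alpha> \<beta>Q[OF x]] by blast
      have "\<gamma> (\<beta> x \<otimes> v) = x \<otimes> \<gamma> v"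
        using H(4)[OF \<gamma> \<beta>Q[OF x] VQ[OF v(1)]] \<beta>(3)[OF x] by simp
      then have "compose Q (compose Q \<gamma> \<alpha>) \<beta> x = x \<otimes> \<gamma> v" using val[OF x] v(2) by simp
      then show ?thesis using im[OF \<gamma> v(1)] unfolding \<beta>_def by blast
    qed
  qed
  have one_D: "restrict id Q \<in> D"
  proof (rule DI)
    show "restrict id Q \<in> Hom Q Q" using inclusion_Hom Q(1) by blast
    show "\<exists>v\<in>V. restrict id Q x = x \<otimes> v" if "x \<in> Q" for x
      using that by (intro bexI[of _ \<one>]) auto
  qed (use VQ in simp)
  show normal: "D \<lhd> Aut Q"
    unfolding AutQ.normal_inv_iff
  proof (intro conjI ballI)
    show "subgroup D (Aut Q)"
      by (rule AutQ.subgroupI) (use one_D inv_D mult_D D_H in auto)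
    show "\<And>\<gamma> \<alpha>. \<gamma> \<in> carrier (Aut Q) \<Longrightarrow> \<alpha> \<in> D \<Longrightarrow>
        \<gamma> \<otimes>\<^bsub>Aut Q\<^esub> \<alpha> \<otimes>\<^bsub>Aut Q\<^esub> inv\<^bsub>Aut Q\<^esub> \<gamma> \<in> D"
      using conj_D by simp
  qed
  \<comment> \<open>An element of D moves x by some v that it fixes and whose order divides p, so D
    has exponent dividing p.\<close>
  have "\<alpha> [^]\<^bsub>Aut Q\<^esub> (p ^ 1) = \<one>\<^bsub>Aut Q\<^esub>" if \<alpha>: "\<alpha> \<in> D" for \<alpha>
  proof -
    have "(\<alpha> ^^ p) x = x" if x: "x \<in> Q" for x
    proof -
      obtain v where v: "v \<in> V" "\<alpha> x = x \<otimes> v" using D_Q[OF \<alpha> x] by blast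
      have "(\<alpha> ^^ p) x = x \<otimes> v [^] p"
        by (rule endo_funpow_translate[OF Q(1) H(2,4)[OF D_H[OF \<alpha>]] x VQ[OF v(1)] v(2) D_V[OF \<alpha> v(1)]])
      then show ?thesis using V_pow[OF v(1)] x by simp
    qed
    then show ?thesis using Aut_pow_eq_one_iff[OF Q(1) D_H[OF \<alpha>], of p] by simp
  qed
  then show "D \<subseteq> HomS G Q Q"
    using AutQ.normal_p_subset_sylow[OF prime_p _ subgroup_HomS[OF Q(1)] _ normal] sylow_HomS[OF Q]
      finite_Hom[OF Q(1) Q(1)] by (metis Aut_simps(1))
qed

section \<open>The downward induction\<close>

lemma Aut_fully_normalized:
  assumes Q: "subgroup Q G" "fully_normalized G Hom Q"
    and larger: "\<And>R. subgroup R G \<Longrightarrow> card Q < card R \<Longrightarrow> Hom R (carrier G) \<subseteq> HomS G R (carrier G)"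
  shows "Hom Q Q \<subseteq> HomS G Q Q"
proof -
  interpret AutQ: group "Aut Q" by (rule group_Aut[OF Q(1)])
  interpret Q: subgroup Q G by (rule Q(1))
  obtain A where A: "max_normal_elementary_abelian G p A"
    by (rule exists_max_normal_elementary_abelian)
  interpret max_normal_elementary_abelian G p A by (rule A)
  show ?thesis
  proof (cases "A \<subseteq> Q")
    case True
    \<comment> \<open>Here the whole automorphism group consists of elements of p-power order; taken
      as a normal subgroup of itself it lies in the Sylow subgroup Aut_S(Q).\<close>
    have "carrier (Aut Q) \<lhd> Aut Q"
      unfolding AutQ.normal_inv_iff using AutQ.subgroup_self by (simp del: Aut_simps)
    then have "carrier (Aut Q) \<subseteq> HomS G Q Q"
      using AutQ.normal_p_subset_sylow[OF prime_p _ subgroup_HomS[OF Q(1)] _ , of "carrier (Aut Q)"]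
        sylow_HomS[OF Q] finite_Hom[OF Q(1) Q(1)] Aut_prime_power_order[OF A Q(1) True] by simp
    then show ?thesis by simp
  next
    case False
    obtain k where "card (carrier G) = p ^ k" using ord_power by blast
    then obtain n where "upper_central G n = carrier G"
      using upper_central_exhausts[OF prime_p fin] by blast
    then have "\<not> A \<inter> upper_central G n \<subseteq> Q" using False A.subset by blast
    moreover have "A \<inter> upper_central G 0 \<subseteq> Q" by auto
    ultimately obtain i where i: "A \<inter> upper_central G i \<subseteq> Q" "\<not> A \<inter> upper_central G (Suc i) \<subseteq> Q"
      using ascending_jump[of "\<lambda>i. A \<inter> upper_central G i \<subseteq> Q" n] by blast
    define V where "V = A \<inter> upper_central G i"
    interpret Z: normal "upper_central G i" G by (rule normal_upper_central)
    have V: "V \<lhd> G" unfolding V_def by (intro normal_subgroup_intersect normal_A normal_upper_central)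
    have elV: "elementary_abelian p G V"
      by (rule elementary_abelian_subset[OF elementary_A normal_imp_subgroup[OF V]]) (simp add: V_def)
    have VQ: "V \<subseteq> Q" using i(1) by (simp add: V_def)
    obtain g where g: "g \<in> A" "g \<in> upper_central G (Suc i)" "g \<notin> Q" using i(2) by blast
    have gc: "g \<in> carrier G" using g(1) by simp
    \<comment> \<open>The commutator is in A because A is normal and contains g, and in the i-th
      term because g is in the next one.\<close>
    have comm: "inv x \<otimes> (g \<otimes> x \<otimes> inv g) \<in> V" if x: "x \<in> carrier G" for x
    proof -
      have "inv x \<otimes> g \<otimes> x \<otimes> inv g \<in> A"
        using A.inv_op_closed1[OF x g(1)] g(1) by blast
      then show ?thesis
        using upper_central_commutator[OF g(2) x] x gc by (simp add: V_def m_assoc)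
    qed
    have conj_eq: "\<exists>v\<in>V. g \<otimes> x \<otimes> inv g = x \<otimes> v" if "x \<in> Q" for x
      using comm[of x] that gc by (intro bexI[of _ "inv x \<otimes> (g \<otimes> x \<otimes> inv g)"]) (simp_all add: r_inv_cancel)
    have conjQ: "g \<otimes> x \<otimes> inv g \<in> Q" if "x \<in> Q" for x
      using conj_eq[OF that] that VQ by auto
    have gN: "g \<in> normalizerS G Q" by (rule normalizerS_I[OF fin gc Q.subset conjQ])
    define D where "D = {\<alpha> \<in> Hom Q Q. (\<forall>v\<in>V. \<alpha> v = v) \<and> (\<forall>x\<in>Q. \<exists>v\<in>V. \<alpha> x = x \<otimes> v)}"
    have D: "D \<lhd> Aut Q" "D \<subseteq> HomS G Q Q"
      unfolding D_def by (rule stability_subset_HomS[OF Q V elV VQ])+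
    define c where "c = restrict (\<lambda>x. g \<otimes> x \<otimes> inv g) Q"
    have "c \<in> HomS G Q Q"
      by (rule HomS_I[OF Q(1) Q(1) _ _ gc]) (use conjQ in \<open>auto simp: c_def\<close>)
    then have cH: "c \<in> Hom Q Q" using HomS_subset Q(1) by blast
    have "c v = v" if "v \<in> V" for v
    proof -
      have vA: "v \<in> A" "v \<in> Q" using that VQ by (auto simp: V_def)
      then have "g \<otimes> v \<otimes> inv g = v" using A_comm[OF g(1) vA(1)] gc by (simp add: m_assoc)
      then show ?thesis using vA by (simp add: c_def)
    qed
    then have cD: "c \<in> D" using cH conj_eq by (simp add: D_def c_def)
    show ?thesis
    proof
      fix \<alpha> assume \<alpha>: "\<alpha> \<in> Hom Q Q"
      note H = HomD[OF Q(1) Q(1)] and I = Aut_inv[OF Q(1) \<alpha>]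
      have \<alpha>G: "\<alpha> \<in> Hom Q (carrier G)" by (rule Hom_mono[OF Q(1) Q(1) subgroup_self Q.subset \<alpha>])
      have im: "\<alpha> ` Q = Q"
        using H(2,3)[OF \<alpha>] endo_inj_surj[OF finite_subgroup[OF Q(1)]] by blast
      \<comment> \<open>Normality of D puts the \<alpha>-conjugate of c in D, hence among the maps
        induced by S. Evaluated at \<alpha> x, this is the relation that puts g in the extension
        domain of \<alpha>.\<close>
      define \<gamma> where "\<gamma> = compose Q (compose Q \<alpha> c) (inv\<^bsub>Aut Q\<^esub> \<alpha>)"
      have "\<gamma> \<in> D"
        using D(1) \<alpha> cD unfolding AutQ.normal_inv_iff \<gamma>_def by simp
      then obtain h where h: "h \<in> carrier G" "\<forall>y\<in>Q. \<gamma> y = h \<otimes> y \<otimes> inv h"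
        using D(2) HomS_D by blast
      have "\<alpha> (g \<otimes> x \<otimes> inv g) = h \<otimes> \<alpha> x \<otimes> inv h" if x: "x \<in> Q" for x
      proof -
        have \<alpha>x: "\<alpha> x \<in> Q" using H(2)[OF \<alpha>] x by blast
        have "\<gamma> (\<alpha> x) = \<alpha> (c x)"
          using I(2)[OF x] x \<alpha>x by (simp add: \<gamma>_def compose_def)
        then show ?thesis using h(2) \<alpha>x x by (simp add: c_def)
      qed
      then have "g \<in> N_phi G Q \<alpha>"
        unfolding N_phi_iff[OF Q(1) \<alpha>G] using gN h(1) by blast
      then obtain k where "k \<in> carrier G" "\<forall>x\<in>Q. \<alpha> x = k \<otimes> x \<otimes> inv k"
        using extends_imp_conj[OF Q(1) \<alpha>G Q(1) im Q(2) _ g(3) larger] by blast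
      then show "\<alpha> \<in> HomS G Q Q"
        by (intro HomS_I[OF Q(1) Q(1) H(1,2)[OF \<alpha>]]) auto
    qed
  qed
qed

text \<open>Transporting c_g along \<psi>, for g normalizing P, gives an automorphism of Q. All of
  these are induced by S, so g lies in the extension domain of \<psi>; a suitable g outside P exists
  unless P is the whole group, and then \<psi> is itself an automorphism of Q.\<close>

lemma iso_to_fully_normalized:
  assumes Q: "subgroup Q G" "fully_normalized G Hom Q"
    and larger: "\<And>R. subgroup R G \<Longrightarrow> card Q < card R \<Longrightarrow> Hom R (carrier G) \<subseteq> HomS G R (carrier G)"
    and P: "subgroup P G" and \<psi>: "\<psi> \<in> Hom P Q" "\<psi> ` P = Q"
  shows "\<exists>h\<in>carrier G. \<forall>x\<in>P. \<psi> x = h \<otimes> x \<otimes> inv h"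
proof -
  interpret P: subgroup P G by (rule P)
  interpret Q: subgroup Q G by (rule Q(1))
  note D = HomD[OF P Q(1) \<psi>(1)]
  have AutQ: "Hom Q Q \<subseteq> HomS G Q Q" by (rule Aut_fully_normalized[OF Q larger])
  have card: "card P = card Q" using \<psi>(2) card_image[OF D(3)] by simp
  have \<psi>G: "\<psi> \<in> Hom P (carrier G)" by (rule Hom_mono[OF P Q(1) subgroup_self Q.subset \<psi>(1)])
  show ?thesis
  proof (cases "P = carrier G")
    case True
    then have "Q = P" using card card_subset_eq[OF fin Q.subset] by simp
    then show ?thesis using AutQ \<psi>(1) HomS_D by blast
  next
    case False
    obtain k where "card (carrier G) = p ^ k" using p_grp by (auto simp: p_group_def)
    then obtain g where g: "g \<in> normalizerS G P" "g \<notin> P"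
      using proper_subgroup_normalizerS[OF prime_p fin _ P False] by blast
    have gc: "g \<in> carrier G" and gP: "\<And>x. x \<in> P \<Longrightarrow> g \<otimes> x \<otimes> inv g \<in> P"
      using normalizerS_D[OF g(1)] by blast+
    define c where "c = restrict (\<lambda>x. g \<otimes> x \<otimes> inv g) P"
    have "c \<in> HomS G P P"
      by (rule HomS_I[OF P P _ _ gc]) (use gP in \<open>auto simp: c_def\<close>)
    then have cH: "c \<in> Hom P P" using HomS_subset P by blast
    define \<chi> where "\<chi> = restrict (inv_into P \<psi>) Q"
    have \<chi>H: "\<chi> \<in> Hom Q P" using Hom_inverse[OF P Q(1) \<psi>(1)] \<psi>(2) by (simp add: \<chi>_def)
    have "compose Q \<psi> (compose Q c \<chi>) \<in> Hom Q Q"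
      by (rule Hom_compose[OF Q(1) P Q(1) Hom_compose[OF Q(1) P P \<chi>H cH] \<psi>(1)])
    then obtain h where h: "h \<in> carrier G" "\<forall>y\<in>Q. compose Q \<psi> (compose Q c \<chi>) y = h \<otimes> y \<otimes> inv h"
      using AutQ HomS_D by blast
    have "\<psi> (g \<otimes> x \<otimes> inv g) = h \<otimes> \<psi> x \<otimes> inv h" if x: "x \<in> P" for x
    proof -
      have "\<psi> x \<in> Q" using D(2) x by blast
      moreover have "\<chi> (\<psi> x) = x" using x D(3) \<psi>(2) by (auto simp: \<chi>_def)
      ultimately have "compose Q \<psi> (compose Q c \<chi>) (\<psi> x) = \<psi> (g \<otimes> x \<otimes> inv g)"
        using x by (simp add: compose_def c_def)
      then show ?thesis using h(2) \<open>\<psi> x \<in> Q\<close> by simp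
    qed
    then have "g \<in> N_phi G P \<psi>"
      unfolding N_phi_iff[OF P \<psi>G] using g(1) h(1) by blast
    then show ?thesis
      using extends_imp_conj[OF P \<psi>G Q(1) \<psi>(2) Q(2) _ g(2)] larger card by simp
  qed
qed

text \<open>The image R of \<phi> need not be fully normalized, so \<phi> is compared with two
  isomorphisms onto a fully normalized Q: \<psi> from P, given by h, and \<psi> after the inverse of
  \<phi> from R, given by k. Then \<phi> is conjugation by \<open>inv k \<otimes> h\<close>.\<close>

lemma Hom_subset_HomS:
  assumes "subgroup P G"
  shows "Hom P (carrier G) \<subseteq> HomS G P (carrier G)"
  using assms
proof (induction "card (carrier G) - card P" arbitrary: P rule: less_induct)
  case less
  note P = \<open>subgroup P G\<close>
  have larger: "Hom R (carrier G) \<subseteq> HomS G R (carrier G)" if R: "subgroup R G" "card P < card R" for R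
  proof (rule less.hyps[OF _ R(1)])
    \<comment> \<open>The bound keeps the truncated subtraction in the induction measure strictly
      decreasing.\<close>
    have "card R \<le> card (carrier G)" using R(1) fin by (simp add: card_mono subgroup.subset)
    then show "card (carrier G) - card R < card (carrier G) - card P" using R(2) by simp
  qed
  obtain Q where Q: "subgroup Q G" "F_conj Hom P Q" "fully_normalized G Hom Q"
    using exists_fully_normalized[OF P] by blast
  have card: "card Q = card P" by (rule F_conj_card[OF P Q(1,2)])
  obtain \<psi> where \<psi>: "\<psi> \<in> Hom P Q" "\<psi> ` P = Q" using Q F_conj_iff P by blast
  have iso: "\<exists>h\<in>carrier G. \<forall>x\<in>R. \<chi> x = h \<otimes> x \<otimes> inv h"
    if "subgroup R G" "\<chi> \<in> Hom R Q" "\<chi> ` R = Q" for R \<chi>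
    by (rule iso_to_fully_normalized[OF Q(1,3) _ that]) (use larger card in simp)
  obtain h where h: "h \<in> carrier G" "\<forall>x\<in>P. \<psi> x = h \<otimes> x \<otimes> inv h"
    using iso[OF P \<psi>] by blast
  show ?case
  proof
    fix \<phi> assume \<phi>: "\<phi> \<in> Hom P (carrier G)"
    note D = HomD[OF P subgroup_self \<phi>]
    define R where "R = \<phi> ` P"
    have R: "subgroup R G" unfolding R_def by (rule subgroup_image[OF P subgroup_self \<phi>])
    define \<theta> where "\<theta> = restrict (inv_into P \<phi>) R"
    have \<theta>: "\<theta> \<in> Hom R P" unfolding \<theta>_def R_def by (rule Hom_inverse[OF P subgroup_self \<phi>])
    have val: "compose R \<psi> \<theta> (\<phi> x) = \<psi> x" if "x \<in> P" for x
      using that D(3) by (simp add: compose_def \<theta>_def R_def)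
    have "compose R \<psi> \<theta> ` R = Q"
      using val \<psi>(2) by (force simp: R_def image_image)
    then obtain k where k: "k \<in> carrier G" "\<forall>y\<in>R. compose R \<psi> \<theta> y = k \<otimes> y \<otimes> inv k"
      using iso[OF R Hom_compose[OF R P Q(1) \<theta> \<psi>(1)]] by blast
    show "\<phi> \<in> HomS G P (carrier G)"
    proof (rule HomS_I[OF P subgroup_self D(1,2), where g = "inv k \<otimes> h"])
      fix x assume x: "x \<in> P"
      have xc: "x \<in> carrier G" and \<phi>x: "\<phi> x \<in> carrier G" "\<phi> x \<in> R"
        using x P D(2) subgroup.mem_carrier by (auto simp: R_def Pi_iff)
      have "k \<otimes> \<phi> x \<otimes> inv k = h \<otimes> x \<otimes> inv h"
        using val[OF x] k(2) h(2) x \<phi>x by simp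
      then have "inv k \<otimes> (k \<otimes> \<phi> x \<otimes> inv k) \<otimes> k = inv k \<otimes> (h \<otimes> x \<otimes> inv h) \<otimes> k" by simp
      then show "\<phi> x = inv k \<otimes> h \<otimes> x \<otimes> inv (inv k \<otimes> h)"
        using xc \<phi>x k(1) h(1) by (simp add: word_simps)
    qed (use h k in simp)
  qed
qed

lemma nilpotent: "nilpotent_fs G Hom"
  unfolding nilpotent_fs_def
proof (intro allI impI)
  fix P Q assume "subgroup P G \<and> subgroup Q G"
  then have P: "subgroup P G" and Q: "subgroup Q G" by auto
  have "\<phi> \<in> HomS G P Q" if \<phi>: "\<phi> \<in> Hom P Q" for \<phi>
  proof -
    have "\<phi> \<in> Hom P (carrier G)"
      by (rule Hom_mono[OF P Q subgroup_self subgroup.subset[OF Q] \<phi>])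
    then obtain g where "g \<in> carrier G" "\<forall>x\<in>P. \<phi> x = g \<otimes> x \<otimes> inv g"
      using Hom_subset_HomS[OF P] HomS_D by blast
    then show ?thesis using HomD[OF P Q \<phi>] by (intro HomS_I[OF P Q]) auto
  qed
  then show "Hom P Q = HomS G P Q" using HomS_subset[OF P Q] by blast
qed

end

section \<open>The converse: when all morphisms come from S\<close>

lemma (in p_fusion_system) nilpotent_imp_weakly_closed:
  assumes nil: "nilpotent_fs G Hom" and V: "V \<lhd> G"
  shows "weakly_closed G Hom V"
  unfolding weakly_closed_def
proof (intro allI impI)
  interpret V: normal V G by (rule V)
  fix W assume "subgroup W G \<and> F_conj Hom V W"
  then have W: "subgroup W G" "F_conj Hom V W" by auto
  then obtain \<phi> where \<phi>: "\<phi> \<in> Hom V W" "\<phi> ` V = W"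
    using F_conj_iff V.subgroup_axioms by blast
  then obtain g where g: "g \<in> carrier G" "\<forall>x\<in>V. \<phi> x = g \<otimes> x \<otimes> inv g"
    using nil V.subgroup_axioms W(1) HomS_D unfolding nilpotent_fs_def by metis
  then have "W \<subseteq> V" using \<phi>(2) V.inv_op_closed2[OF g(1)] by auto
  then show "W = V"
    using F_conj_card[OF V.subgroup_axioms W] card_subset_eq finite_subgroup[OF V.subgroup_axioms] by blast
qed

text \<open>The n-th iterate of c_g is conjugation by \<open>g [^] n\<close>, so every element of
  Aut_S(V) has order dividing |S|, and a group of elements of p-power order has p-power
  order.\<close>

lemma (in p_fusion_system) card_HomS_normal:
  assumes V: "V \<lhd> G"
  shows "\<exists>k. card (HomS G V V) = p ^ k"
proof -
  interpret V: normal V G by (rule V)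
  note sub = V.subgroup_axioms
  interpret AutV: group "Aut V" by (rule group_Aut[OF sub])
  let ?H = "HomS G V V"
  have H: "subgroup ?H (Aut V)" by (rule subgroup_HomS[OF sub])
  interpret HV: group "Aut V\<lparr>carrier := ?H\<rparr>" by (rule AutV.subgroup_imp_group[OF H])
  obtain m where m: "card (carrier G) = p ^ m" using p_grp by (auto simp: p_group_def)
  have "\<exists>n. \<alpha> [^]\<^bsub>Aut V\<lparr>carrier := ?H\<rparr>\<^esub> (p ^ n) = \<one>\<^bsub>Aut V\<^esub>" if \<alpha>: "\<alpha> \<in> ?H" for \<alpha>
  proof -
    have \<alpha>H: "\<alpha> \<in> Hom V V" using HomS_subset[OF sub sub] \<alpha> by blast
    obtain g where g: "g \<in> carrier G" "\<forall>x\<in>V. \<alpha> x = g \<otimes> x \<otimes> inv g"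
      using HomS_D[OF \<alpha>] by blast
    have "(\<alpha> ^^ n) x = g [^] n \<otimes> x \<otimes> inv (g [^] n)" if x: "x \<in> V" for x and n :: nat
    proof (induction n)
      case (Suc n)
      have "g [^] n \<otimes> x \<otimes> inv (g [^] n) \<in> V" by (rule V.inv_op_closed2) (use g x in auto)
      then have "(\<alpha> ^^ Suc n) x = g \<otimes> (g [^] n \<otimes> x \<otimes> inv (g [^] n)) \<otimes> inv g"
        using g Suc by simp
      also have "\<dots> = (g \<otimes> g [^] n) \<otimes> x \<otimes> inv (g \<otimes> g [^] n)"
        using g x by (simp add: word_simps)
      finally show ?case using g nat_pow_Suc2[of g n] by simp
    qed (use x in simp)
    moreover have "g [^] (p ^ m) = \<one>"
      using pow_order_eq_1[OF g(1)] m by (simp add: order_def)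
    ultimately have "\<alpha> [^]\<^bsub>Aut V\<^esub> (p ^ m) = \<one>\<^bsub>Aut V\<^esub>"
      using Aut_pow_eq_one_iff[OF sub \<alpha>H, of "p ^ m"] by simp
    then show ?thesis
      by (auto simp flip: AutV.nat_pow_consistent)
  qed
  then show ?thesis
    using HV.prime_order_elements_imp_prime_power[OF prime_p] finite_subset[OF HomS_subset[OF sub sub] finite_Hom[OF sub sub]]
    by simp
qed

theorem theorem5p4:
  fixes p :: nat and S :: "('a,'b) monoid_scheme"
    and Hom :: "'a set \<Rightarrow> 'a set \<Rightarrow> ('a \<Rightarrow> 'a) set"
    and Mor :: "'a set \<Rightarrow> 'a set \<Rightarrow> 'm set"
    and cmp :: "'a set \<Rightarrow> 'a set \<Rightarrow> 'a set \<Rightarrow> 'm \<Rightarrow> 'm \<Rightarrow> 'm"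
    and ide :: "'a set \<Rightarrow> 'm" and \<pi> :: "'a set \<Rightarrow> 'a set \<Rightarrow> 'm \<Rightarrow> ('a \<Rightarrow> 'a)"
    and \<delta> :: "'a set \<Rightarrow> 'a \<Rightarrow> 'm"
  assumes "Factorial_Ring.prime p" and "odd p"
    and "p_group p S"
    and "saturated p S Hom"
    and "linking_system S Hom Mor cmp ide \<pi> \<delta>"
  shows "nilpotent_fs S Hom \<longleftrightarrow>
    (\<forall>V. V \<lhd> S \<and> elementary_abelian p S V \<longrightarrow>
       weakly_closed S Hom V \<and> (\<exists>k. card (Hom V V) = p ^ k))"
proof -
  interpret group S using assms(3) by (simp add: p_group_def)
  interpret p_fusion_system S p Hom
    by unfold_locales (use assms in \<open>auto simp: saturated_def\<close>)
  show ?thesis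
  proof (intro iffI allI impI)
    fix V assume nil: "nilpotent_fs S Hom" and "V \<lhd> S \<and> elementary_abelian p S V"
    then have V: "V \<lhd> S" by simp
    then have "Hom V V = HomS S V V"
      using nil normal_imp_subgroup unfolding nilpotent_fs_def by blast
    then show "weakly_closed S Hom V \<and> (\<exists>k. card (Hom V V) = p ^ k)"
      using nilpotent_imp_weakly_closed[OF nil V] card_HomS_normal[OF V] by simp
  next
    assume *: "\<forall>V. V \<lhd> S \<and> elementary_abelian p S V \<longrightarrow>
       weakly_closed S Hom V \<and> (\<exists>k. card (Hom V V) = p ^ k)"
    interpret weakly_closed_fusion_system S p Hom
      by unfold_locales (use assms * in auto)
    show "nilpotent_fs S Hom" by (rule nilpotent)
  qed
qed

end
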